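(* For each $n$, let $p=p(n)$ and $\rho=\rho(n)\in\mathbb{R}^p$, and let $\sigma>0$ be a fixed constant. Observe $x_1,\dots,x_n\in\mathbb{R}^p$ from the single component model $$x_i = v_i\rho+\sigma z_i,\qquad i=1,\dots,n,$$ where $v_1,\dots,v_n$ are i.i.d. $N(0,1)$, $z_1,\dots,z_n$ are i.i.d. $N_p(0,I_p)$, and all the $v_i$ and $z_i$ are mutually independent. Assume $\lim_{n\to\infty} p(n)/n=c\in[0,\infty)$ and $\lim_{n\to\infty}\|\rho(n)\|=\varrho>0$. Let $S=n^{-1}\sum_{i=1}^n x_ix_i^T$ and let $\hat\rho$ be a unit eigenvector of $S$ associated with its largest eigenvalue. Define $$\zeta(\tau;c)=\frac{4\sqrt c}{\tau}\Bigl(1+\frac{2+\sqrt c}{\tau}\Bigr).$$ Then, provided $\zeta(\varrho/\sigma;c)\le 1$, with probability one $$\limsup_{n\to\infty}\ \sin\angle(\hat\rho,\rho)\le \zeta(\varrho/\sigma;c).$$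
   Context: For nonzero $\xi,\eta\in\mathbb{R}^p$, the angle is $\angle(\xi,\eta)=\cos^{-1}\bigl(|\xi^T\eta|/(\|\xi\|_2\|\eta\|_2)\bigr)\in[0,\pi/2]$; in particular it does not depend on the signs of $\xi,\eta$, and $\sin\angle(\hat\rho,\rho)=\sqrt{1-(\rho^T\hat\rho)^2/\|\rho\|^2}$ for unit $\hat\rho$. All quantities $p,\rho$ may depend on $n$; $\sigma$ does not. *)

theory Defs
  imports "HOL-Probability.Probability"
begin

text \<open>Vectors in R^p are represented as functions nat => real, only the
  coordinates j < p are relevant; p x p matrices as nat => nat => real.\<close>

definition sample_cov :: "nat \<Rightarrow> nat \<Rightarrow> (nat \<Rightarrow> nat \<Rightarrow> real) \<Rightarrow> nat \<Rightarrow> nat \<Rightarrow> real" where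
  "sample_cov n p x j k = (1 / real n) * (\<Sum>i<n. x i j * x i k)"

definition mat_vec :: "nat \<Rightarrow> (nat \<Rightarrow> nat \<Rightarrow> real) \<Rightarrow> (nat \<Rightarrow> real) \<Rightarrow> nat \<Rightarrow> real" where
  "mat_vec p A u j = (\<Sum>k<p. A j k * u k)"

definition vnorm :: "nat \<Rightarrow> (nat \<Rightarrow> real) \<Rightarrow> real" where
  "vnorm p u = sqrt (\<Sum>j<p. (u j)\<^sup>2)"

definition vdot :: "nat \<Rightarrow> (nat \<Rightarrow> real) \<Rightarrow> (nat \<Rightarrow> real) \<Rightarrow> real" where
  "vdot p u w = (\<Sum>j<p. u j * w j)"

definition is_eigenpair :: "nat \<Rightarrow> (nat \<Rightarrow> nat \<Rightarrow> real) \<Rightarrow> real \<Rightarrow> (nat \<Rightarrow> real) \<Rightarrow> bool" where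
  "is_eigenpair p A lam u \<longleftrightarrow> (\<exists>j<p. u j \<noteq> 0) \<and> (\<forall>j<p. mat_vec p A u j = lam * u j)"

definition is_top_unit_eigvec :: "nat \<Rightarrow> (nat \<Rightarrow> nat \<Rightarrow> real) \<Rightarrow> (nat \<Rightarrow> real) \<Rightarrow> bool" where
  "is_top_unit_eigvec p A u \<longleftrightarrow> vnorm p u = 1 \<and>
     (\<exists>lam. is_eigenpair p A lam u \<and> (\<forall>\<mu> w. is_eigenpair p A \<mu> w \<longrightarrow> \<mu> \<le> lam))"

text \<open>sin of the (sign-free) angle between u and w.\<close>
definition sin_angle :: "nat \<Rightarrow> (nat \<Rightarrow> real) \<Rightarrow> (nat \<Rightarrow> real) \<Rightarrow> real" where
  "sin_angle p u w = sqrt (1 - (vdot p u w)\<^sup>2 / ((vnorm p u)\<^sup>2 * (vnorm p w)\<^sup>2))"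

definition zeta :: "real \<Rightarrow> real \<Rightarrow> real" where
  "zeta \<tau> c = 4 * sqrt c / \<tau> * (1 + (2 + sqrt c) / \<tau>)"

end

theory Submission
  imports Defs
begin

text \<open>
  Write \<open>r\<close> for the norm of \<open>\<rho>\<close>, \<open>A = n\<^sup>-\<^sup>1 \<Sum>i. v\<^sub>i\<^sup>2\<close>, \<open>b = n\<^sup>-\<^sup>1 \<Sum>i. v\<^sub>i z\<^sub>i\<close>, and let \<open>K\<close> bound
  the operator norm of \<open>W - I\<close>, where \<open>W = n\<^sup>-\<^sup>1 \<Sum>i. z\<^sub>i z\<^sub>i\<^sup>T\<close>. Comparing the Rayleigh
  quotients of \<open>S\<close> at its top eigenvector and at \<open>\<rho> / r\<close> gives, for the sine \<open>s\<close> of their angle,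
  \<open>A r\<^sup>2 s \<le> 2 \<sigma> r |b| + 2 \<sigma>\<^sup>2 K\<close>. The first term uses only half of what \<open>\<zeta>\<close> allows, so a
  suboptimal estimate of \<open>K\<close> suffices.

  The chi-square tail bounds of Laurent and Massart give \<open>liminf A \<ge> 1\<close> and, conditionally
  on the \<open>v\<^sub>i\<close>, \<open>limsup |b| / \<surd>A \<le> \<surd>c\<close>. For \<open>K\<close>, a union bound controls \<open>W - I\<close> by
  \<open>t = 2 \<surd>x + 2 x\<close>, \<open>x \<approx> 8 c / 3\<close>, on the at most \<open>exp (8 p / 3)\<close> integer points of the ball
  of radius \<open>3 \<surd>p\<close>. Rounding a vector of norm \<open>2 \<surd>p\<close> coordinate by coordinate so that the
  quadratic form does not decrease much yields \<open>K \<le> 9 t / 8\<close>. In the limit the sine is at most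
  \<open>2 \<surd>c / \<tau> + (9/4) (2 \<surd>(8c/3) + 16 c / 3) / \<tau>\<^sup>2\<close>, which is below \<open>\<zeta>(\<tau>; c)\<close> because
  \<open>\<zeta>(\<tau>; c) \<le> 1\<close> forces \<open>\<tau> \<ge> 4 \<surd>c\<close>.
\<close>

section \<open>Chi-square tails\<close>

text \<open>With \<open>u = 1 + w\<close> the right side is \<open>(u - 1 / u) / 2\<close>, and its
  difference to \<open>ln u\<close> has derivative \<open>(1 - 1 / u)^2 / 2\<close>. At
  \<open>w = 2 * s\<close> it bounds the log-moment generating function in the upper tail tightly
  enough to leave the exponent exactly \<open>- x\<close>.\<close>

lemma ln_one_plus_le:
  fixes w :: real
  assumes "w \<ge> 0"
  shows "ln (1 + w) \<le> w * (2 + w) / (2 * (1 + w))"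
proof -
  define g where "g = (\<lambda>w::real. ((1 + w) - 1 / (1 + w)) / 2 - ln (1 + w))"
  have "g 0 \<le> g w"
  proof (rule DERIV_nonneg_imp_nondecreasing[OF assms])
    fix x :: real assume x: "0 \<le> x" "x \<le> w"
    have "(g has_real_derivative (1 + 1 / (1 + x)\<^sup>2) / 2 - 1 / (1 + x)) (at x)"
      unfolding g_def using x
      by (auto intro!: derivative_eq_intros simp: field_simps power2_eq_square)
    moreover have "(1 + 1 / (1 + x)\<^sup>2) / 2 - 1 / (1 + x) = (1 - 1 / (1 + x))\<^sup>2 / 2"
      by (simp add: power2_diff power_divide)
    ultimately show "\<exists>y. (g has_real_derivative y) (at x) \<and> 0 \<le> y"
      by (metis divide_nonneg_nonneg zero_le_numeral zero_le_power2)
  qed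
  moreover have "((1 + w) - 1 / (1 + w)) / 2 = w * (2 + w) / (2 * (1 + w))"
    using assms by (simp add: field_simps)
  ultimately show ?thesis by (simp add: g_def)
qed

text \<open>The difference of the two sides has derivative \<open>x^2 / (1 + x)\<close>. This is the
  counterpart for the lower tail, where a negative Chernoff weight makes the second-order expansion
  a one-sided bound.\<close>

lemma ln_one_plus_ge:
  fixes w :: real
  assumes "w \<ge> 0"
  shows "w - w\<^sup>2 / 2 \<le> ln (1 + w)"
proof -
  define g where "g = (\<lambda>w::real. ln (1 + w) - w + w\<^sup>2 / 2)"
  have "g 0 \<le> g w"
  proof (rule DERIV_nonneg_imp_nondecreasing[OF assms])
    fix x :: real assume x: "0 \<le> x" "x \<le> w"
    have "(g has_real_derivative 1 / (1 + x) - 1 + x) (at x)"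
      unfolding g_def using x by (auto intro!: derivative_eq_intros)
    moreover have "1 / (1 + x) - 1 + x = x\<^sup>2 / (1 + x)"
      using x by (simp add: field_simps power2_eq_square)
    ultimately show "\<exists>y. (g has_real_derivative y) (at x) \<and> 0 \<le> y"
      using x by (metis add_nonneg_nonneg divide_nonneg_nonneg zero_le_one zero_le_power2)
  qed
  then show ?thesis by (simp add: g_def)
qed

text \<open>Tilting the standard normal density by \<open>exp (l * x^2)\<close> gives a centred
  normal density of variance \<open>1 / (1 - 2 * l)\<close>, up to the factor \<open>s\<close>,
  which is therefore the integral.\<close>

lemma nn_integral_std_normal_exp_square:
  fixes l :: real
  assumes "l < 1 / 2"
  shows "(\<integral>\<^sup>+x. ennreal (std_normal_density x) * ennreal (exp (l * x\<^sup>2)) \<partial>lborel)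
    = ennreal (1 / sqrt (1 - 2 * l))"
proof -
  define s where "s = 1 / sqrt (1 - 2 * l)"
  have s: "s > 0" "s\<^sup>2 = 1 / (1 - 2 * l)"
    using assms by (auto simp: s_def power_divide)
  have eq: "std_normal_density x * exp (l * x\<^sup>2) = s * normal_density 0 s x" for x
  proof -
    have "- x\<^sup>2 / 2 + l * x\<^sup>2 = - x\<^sup>2 / (2 * s\<^sup>2)"
      unfolding s(2) using assms by (simp add: field_simps)
    then have "exp (- x\<^sup>2 / 2) * exp (l * x\<^sup>2) = exp (- x\<^sup>2 / (2 * s\<^sup>2))"
      by (metis exp_add)
    moreover have "sqrt (2 * pi * s\<^sup>2) = s * sqrt (2 * pi)"
      using s(1) by (simp add: real_sqrt_mult)
    ultimately show ?thesis
      using s(1) by (simp add: normal_density_def)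
  qed
  have "(\<integral>\<^sup>+x. ennreal (std_normal_density x) * ennreal (exp (l * x\<^sup>2)) \<partial>lborel)
    = (\<integral>\<^sup>+x. ennreal s * ennreal (normal_density 0 s x) \<partial>lborel)"
    using s(1) by (intro nn_integral_cong) (simp add: eq flip: ennreal_mult')
  also have "\<dots> = ennreal s * (\<integral>\<^sup>+x. ennreal (normal_density 0 s x) \<partial>lborel)"
    by (rule nn_integral_cmult) simp
  also have "(\<integral>\<^sup>+x. ennreal (normal_density 0 s x) \<partial>lborel) = 1"
    using s(1) by (subst nn_integral_eq_integral) auto
  finally show ?thesis by (simp add: s_def)
qed

section \<open>Chernoff bounds for sums of squared standard normals\<close>

context prob_space
begin

text \<open>Markov's inequality for the exponential, whose expectation factorises by independence.
  Keeping \<open>l\<close> inside the event lets one lemma serve both tails: \<open>l > 0\<close>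
  gives the upper one, \<open>l < 0\<close> the lower one.\<close>

lemma std_normal_sum_squares_chernoff:
  fixes X :: "'i \<Rightarrow> 'a \<Rightarrow> real" and l a :: real
  assumes fin: "finite I"
    and ind: "indep_vars (\<lambda>_. borel) X I"
    and dist: "\<And>i. i \<in> I \<Longrightarrow> distributed M lborel (X i) std_normal_density"
    and l: "l < 1 / 2"
  shows "prob {\<omega> \<in> space M. a \<le> l * (\<Sum>i\<in>I. (X i \<omega>)\<^sup>2)}
    \<le> exp (- a - real (card I) * ln (1 - 2 * l) / 2)"
proof -
  have rv[measurable]: "X i \<in> borel_measurable M" if "i \<in> I" for i
    using ind that by (auto simp: indep_vars_def)
  have ind': "indep_vars (\<lambda>_. borel) (\<lambda>i \<omega>. ennreal (exp (l * (X i \<omega>)\<^sup>2))) I"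
    by (rule indep_vars_compose2[OF ind]) measurable
  have one: "(\<integral>\<^sup>+\<omega>. ennreal (exp (l * (X i \<omega>)\<^sup>2)) \<partial>M) = ennreal (1 / sqrt (1 - 2 * l))"
    if "i \<in> I" for i
    using nn_integral_std_normal_exp_square[OF l]
    by (subst distributed_nn_integral[OF dist[OF that], symmetric]) auto
  have prod_eq: "(\<Prod>i\<in>I. ennreal (exp (l * (X i \<omega>)\<^sup>2))) = ennreal (exp (l * (\<Sum>i\<in>I. (X i \<omega>)\<^sup>2)))" for \<omega>
    using fin by (simp add: prod_ennreal exp_sum sum_distrib_left)
  have "emeasure M {\<omega> \<in> space M. a \<le> l * (\<Sum>i\<in>I. (X i \<omega>)\<^sup>2)}
      = emeasure M {\<omega> \<in> space M. 1 \<le> ennreal (exp (- a)) * (\<Prod>i\<in>I. ennreal (exp (l * (X i \<omega>)\<^sup>2)))}"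
    (is "_ = emeasure M ?S")
    by (simp add: prod_eq flip: ennreal_mult'' exp_add)
  also have "\<dots> \<le> ennreal (exp (- a)) * (\<integral>\<^sup>+\<omega>. (\<Prod>i\<in>I. ennreal (exp (l * (X i \<omega>)\<^sup>2))) * indicator (space M) \<omega> \<partial>M)"
    by (rule nn_integral_Markov_inequality) auto
  also have "(\<integral>\<^sup>+\<omega>. (\<Prod>i\<in>I. ennreal (exp (l * (X i \<omega>)\<^sup>2))) * indicator (space M) \<omega> \<partial>M)
      = (\<integral>\<^sup>+\<omega>. (\<Prod>i\<in>I. ennreal (exp (l * (X i \<omega>)\<^sup>2))) \<partial>M)"
    by (intro nn_integral_cong) auto
  also have "\<dots> = (\<Prod>i\<in>I. \<integral>\<^sup>+\<omega>. ennreal (exp (l * (X i \<omega>)\<^sup>2)) \<partial>M)"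
    by (rule indep_vars_nn_integral[OF fin ind']) simp
  also have "\<dots> = ennreal ((1 / sqrt (1 - 2 * l)) ^ card I)"
    using l by (simp add: one ennreal_power)
  also have "1 / sqrt (1 - 2 * l) = exp (- ln (1 - 2 * l) / 2)"
  proof -
    have "sqrt (1 - 2 * l) = exp (ln (1 - 2 * l) / 2)"
      using l by (simp add: ln_sqrt[symmetric])
    then show ?thesis by (simp add: exp_minus field_simps)
  qed
  also have "ennreal (exp (- a)) * ennreal (exp (- ln (1 - 2 * l) / 2) ^ card I)
      = ennreal (exp (- a - real (card I) * ln (1 - 2 * l) / 2))"
    by (simp add: exp_diff exp_minus field_simps flip: ennreal_mult'' exp_of_nat_mult exp_add)
  finally show ?thesis
    by (simp add: emeasure_eq_measure)
qed

lemma std_normal_sum_squares_upper_tail: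
  fixes X :: "'i \<Rightarrow> 'a \<Rightarrow> real" and x :: real
  assumes fin: "finite I" and ne: "I \<noteq> {}"
    and ind: "indep_vars (\<lambda>_. borel) X I"
    and dist: "\<And>i. i \<in> I \<Longrightarrow> distributed M lborel (X i) std_normal_density"
    and x: "x \<ge> 0"
  shows "prob {\<omega> \<in> space M. real (card I) + 2 * sqrt (real (card I) * x) + 2 * x
      \<le> (\<Sum>i\<in>I. (X i \<omega>)\<^sup>2)} \<le> exp (- x)"
proof (cases "x = 0")
  case False
  define m where "m = real (card I)"
  define s where "s = sqrt (x / m)"
  \<comment> \<open>This \<open>l\<close> minimises the exponent once
    \<open>- ln (1 - 2 * l) / 2 - l\<close> has been replaced by its majorant
    \<open>l^2 / (1 - 2 * l)\<close>; the minimum is \<open>- m * s^2 = - x\<close>.\<close>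
  define l where "l = s / (1 + 2 * s)"
  have m: "m > 0" using fin ne by (simp add: m_def card_gt_0_iff)
  have s: "s > 0" using m x False by (simp add: s_def)
  have xs: "x = m * s\<^sup>2" using m x by (simp add: s_def)
  have sq: "sqrt (m * x) = m * s"
    using m s by (simp add: xs real_sqrt_mult power2_eq_square)
  have l: "l > 0" "l < 1 / 2" "1 - 2 * l = 1 / (1 + 2 * s)"
    using s by (auto simp: l_def field_simps)
  have eq: "m + 2 * sqrt (m * x) + 2 * x = m * (1 + 2 * s + 2 * s\<^sup>2)"
    by (simp only: sq) (simp add: xs algebra_simps)
  have "- (l * (m * (1 + 2 * s + 2 * s\<^sup>2))) - m * ln (1 - 2 * l) / 2
      = m * (ln (1 + 2 * s) / 2 - l * (1 + 2 * s + 2 * s\<^sup>2))"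
    unfolding l(3) using s by (simp add: ln_div algebra_simps)
  also have "\<dots> \<le> m * ((2 * s * (2 + 2 * s) / (2 * (1 + 2 * s))) / 2 - l * (1 + 2 * s + 2 * s\<^sup>2))"
    using ln_one_plus_le[of "2 * s"] s m by (intro mult_left_mono diff_right_mono divide_right_mono) auto
  also have "\<dots> = - x"
    using s by (simp add: l_def xs divide_simps) (simp add: power2_eq_square algebra_simps)
  finally have le: "- (l * (m * (1 + 2 * s + 2 * s\<^sup>2))) - m * ln (1 - 2 * l) / 2 \<le> - x" .
  have "prob {\<omega> \<in> space M. m + 2 * sqrt (m * x) + 2 * x \<le> (\<Sum>i\<in>I. (X i \<omega>)\<^sup>2)}
     = prob {\<omega> \<in> space M. l * (m * (1 + 2 * s + 2 * s\<^sup>2)) \<le> l * (\<Sum>i\<in>I. (X i \<omega>)\<^sup>2)}"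
    using l by (simp add: eq)
  also have "\<dots> \<le> exp (- (l * (m * (1 + 2 * s + 2 * s\<^sup>2))) - m * ln (1 - 2 * l) / 2)"
    unfolding m_def by (rule std_normal_sum_squares_chernoff[OF fin ind dist l(2)])
  also have "\<dots> \<le> exp (- x)" using le by simp
  finally show ?thesis by (simp add: m_def)
qed auto

text \<open>The Chernoff weight is \<open>- s\<close>, the minimiser after bounding
  \<open>ln (1 + 2 * s)\<close> below to second order. No linear term in \<open>x\<close> appears,
  unlike in the upper tail, since for negative weights the log-moment generating function is
  dominated by a pure quadratic.\<close>

lemma std_normal_sum_squares_lower_tail:
  fixes X :: "'i \<Rightarrow> 'a \<Rightarrow> real" and x :: real
  assumes fin: "finite I" and ne: "I \<noteq> {}"
    and ind: "indep_vars (\<lambda>_. borel) X I"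
    and dist: "\<And>i. i \<in> I \<Longrightarrow> distributed M lborel (X i) std_normal_density"
    and x: "x \<ge> 0"
  shows "prob {\<omega> \<in> space M. (\<Sum>i\<in>I. (X i \<omega>)\<^sup>2)
      \<le> real (card I) - 2 * sqrt (real (card I) * x)} \<le> exp (- x)"
proof (cases "x = 0")
  case False
  define m where "m = real (card I)"
  define s where "s = sqrt (x / m)"
  have m: "m > 0" using fin ne by (simp add: m_def card_gt_0_iff)
  have s: "s > 0" using m x False by (simp add: s_def)
  have xs: "x = m * s\<^sup>2" using m x by (simp add: s_def)
  have sq: "sqrt (m * x) = m * s"
    using m s by (simp add: xs real_sqrt_mult power2_eq_square)
  have eq: "m - 2 * sqrt (m * x) = m * (1 - 2 * s)"
    by (simp only: sq) (simp add: algebra_simps)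
  have "- (- s * (m * (1 - 2 * s))) - m * ln (1 - 2 * (- s)) / 2
      = m * (s * (1 - 2 * s) - ln (1 + 2 * s) / 2)"
    by (simp add: algebra_simps)
  also have "\<dots> \<le> m * (s * (1 - 2 * s) - (2 * s - (2 * s)\<^sup>2 / 2) / 2)"
    using ln_one_plus_ge[of "2 * s"] s m by (intro mult_left_mono) auto
  also have "\<dots> = - x"
    by (simp add: xs power2_eq_square field_simps)
  finally have le: "- (- s * (m * (1 - 2 * s))) - m * ln (1 - 2 * (- s)) / 2 \<le> - x" .
  have "prob {\<omega> \<in> space M. (\<Sum>i\<in>I. (X i \<omega>)\<^sup>2) \<le> m - 2 * sqrt (m * x)}
     = prob {\<omega> \<in> space M. - s * (m * (1 - 2 * s)) \<le> - s * (\<Sum>i\<in>I. (X i \<omega>)\<^sup>2)}"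
    using s by (simp add: eq)
  also have "\<dots> \<le> exp (- (- s * (m * (1 - 2 * s))) - m * ln (1 - 2 * (- s)) / 2)"
    unfolding m_def by (rule std_normal_sum_squares_chernoff[OF fin ind dist]) (use s in auto)
  also have "\<dots> \<le> exp (- x)" using le by simp
  finally show ?thesis by (simp add: m_def)
qed auto

end

section \<open>Rayleigh quotients\<close>

lemma vnorm_eq_L2_set: "vnorm p u = L2_set u {..<p}"
  by (simp add: vnorm_def L2_set_def)

lemma vnorm_nonneg [simp]: "0 \<le> vnorm p u"
  by (simp add: vnorm_eq_L2_set)

lemma vnorm_sq: "(vnorm p u)\<^sup>2 = vdot p u u"
  by (simp add: vnorm_def vdot_def sum_nonneg power2_eq_square)

lemma vnorm_eq_0_iff: "vnorm p u = 0 \<longleftrightarrow> (\<forall>j<p. u j = 0)"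
  by (auto simp: vnorm_def sum_nonneg_eq_0_iff)

lemma vdot_commute: "vdot p u w = vdot p w u"
  by (simp add: vdot_def mult.commute)

lemma vdot_add_right: "vdot p x (\<lambda>j. u j + w j) = vdot p x u + vdot p x w"
  by (simp add: vdot_def sum.distrib algebra_simps)

lemma vdot_diff_right: "vdot p x (\<lambda>j. u j - w j) = vdot p x u - vdot p x w"
  by (simp add: vdot_def sum_subtractf algebra_simps)

lemma vdot_scale_right: "vdot p x (\<lambda>j. a * u j) = a * vdot p x u"
  by (simp add: vdot_def sum_distrib_left algebra_simps)

lemma vdot_add_left: "vdot p (\<lambda>j. u j + w j) x = vdot p u x + vdot p w x"
  by (simp add: vdot_def sum.distrib algebra_simps)

lemma vdot_diff_left: "vdot p (\<lambda>j. u j - w j) x = vdot p u x - vdot p w x"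
  by (simp add: vdot_def sum_subtractf algebra_simps)

lemma vdot_scale_left: "vdot p (\<lambda>j. a * u j) x = a * vdot p u x"
  by (simp add: vdot_def sum_distrib_left algebra_simps)

lemmas vdot_linear = vdot_add_right vdot_diff_right vdot_scale_right
  vdot_add_left vdot_diff_left vdot_scale_left

lemma vnorm_scale: "vnorm p (\<lambda>j. a * u j) = \<bar>a\<bar> * vnorm p u"
  by (simp add: vnorm_def power_mult_distrib real_sqrt_mult flip: sum_distrib_left)

lemma vnorm_triangle: "vnorm p (\<lambda>j. u j + w j) \<le> vnorm p u + vnorm p w"
  by (simp add: vnorm_eq_L2_set L2_set_triangle_ineq)

lemma vdot_le_vnorm_mult: "vdot p u w \<le> vnorm p u * vnorm p w"
proof -
  have "vdot p u w \<le> (\<Sum>j<p. \<bar>u j\<bar> * \<bar>w j\<bar>)"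
    unfolding vdot_def by (intro sum_mono) (metis abs_ge_self abs_mult)
  also have "\<dots> \<le> vnorm p u * vnorm p w"
    unfolding vnorm_eq_L2_set by (rule L2_set_mult_ineq)
  finally show ?thesis .
qed

lemma abs_vdot_le_vnorm_mult: "\<bar>vdot p u w\<bar> \<le> vnorm p u * vnorm p w"
  using vdot_le_vnorm_mult[of p u w] vdot_le_vnorm_mult[of p u "\<lambda>j. (-1) * w j"]
  unfolding vdot_scale_right vnorm_scale by simp

section \<open>Variational characterisation of the top eigenvalue\<close>

lemma compact_PiE_UNIV:
  fixes B :: "'i \<Rightarrow> 'b::topological_space set"
  assumes "\<And>i. compact (B i)"
  shows "compact (PiE UNIV B)"
proof -
  have "compactin (product_topology (\<lambda>_::'i. euclidean :: 'b topology) UNIV) (PiE UNIV B)"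
    using assms by (simp add: compactin_PiE)
  then show ?thesis by (simp add: euclidean_product_topology)
qed

text \<open>Vectors are functions on all of \<open>nat\<close>, so the set
  \<open>vnorm p y = 1\<close> is not compact: coordinates from \<open>p\<close> on are
  unconstrained. They are pinned to 0, the others confined to \<open>[-1, 1]\<close>, and Tychonoff
  applies; zeroing the tail of an arbitrary \<open>w\<close> changes neither its norm nor the
  form.\<close>

lemma quadratic_form_attains_max:
  assumes p: "p > 0"
  obtains y where "vnorm p y = 1"
    and "\<And>w. vnorm p w = 1 \<Longrightarrow> vdot p w (mat_vec p A w) \<le> vdot p y (mat_vec p A y)"
proof -
  define B where "B = (\<lambda>j. if j < p then {-1..1} else {0::real})"
  define S where "S = PiE UNIV B \<inter> {y. vnorm p y = 1}"
  have coord: "continuous_on UNIV (\<lambda>y::nat \<Rightarrow> real. y j)" for j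
    by simp
  have "closed {y. vnorm p y = 1}"
    unfolding vnorm_def by (intro closed_Collect_eq continuous_intros coord)
  then have "compact S"
    unfolding S_def by (intro compact_Int_closed compact_PiE_UNIV) (auto simp: B_def)
  moreover have "(\<lambda>j. if j = 0 then 1 else 0) \<in> S"
    using p by (auto simp: S_def B_def vnorm_def if_distrib[of "\<lambda>x. x ^ 2"] cong: if_cong)
  moreover have "continuous_on S (\<lambda>y. vdot p y (mat_vec p A y))"
    unfolding vdot_def mat_vec_def
    by (rule continuous_on_subset[OF _ subset_UNIV]) (intro continuous_intros coord)
  ultimately obtain y where y: "y \<in> S"
    and max: "\<And>w. w \<in> S \<Longrightarrow> vdot p w (mat_vec p A w) \<le> vdot p y (mat_vec p A y)"
    using continuous_attains_sup[of S "\<lambda>y. vdot p y (mat_vec p A y)"] by blast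
  show ?thesis
  proof
    show "vnorm p y = 1" using y by (simp add: S_def)
    fix w assume w: "vnorm p w = 1"
    define w' where "w' = (\<lambda>j. if j < p then w j else 0)"
    have "\<bar>w j\<bar> \<le> 1" if "j < p" for j
      using member_le_L2_set[of "{..<p}" j "\<lambda>j. \<bar>w j\<bar>"] that w
      by (simp add: vnorm_eq_L2_set L2_set_def)
    then have "w' j \<in> B j" for j
      by (force simp: B_def w'_def)
    moreover have "vnorm p w' = 1" using w by (simp add: vnorm_def w'_def)
    ultimately have "w' \<in> S" by (auto simp: S_def)
    moreover have "vdot p w' (mat_vec p A w') = vdot p w (mat_vec p A w)"
      by (simp add: vdot_def mat_vec_def w'_def)
    ultimately show "vdot p w (mat_vec p A w) \<le> vdot p y (mat_vec p A y)"
      using max by metis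
  qed
qed

lemma mat_vec_add: "mat_vec p A (\<lambda>j. u j + w j) = (\<lambda>j. mat_vec p A u j + mat_vec p A w j)"
  by (simp add: mat_vec_def fun_eq_iff sum.distrib algebra_simps)

lemma mat_vec_scale: "mat_vec p A (\<lambda>j. a * u j) = (\<lambda>j. a * mat_vec p A u j)"
  by (simp add: mat_vec_def fun_eq_iff sum_distrib_left algebra_simps)

lemma vdot_mat_vec_commute:
  assumes "\<And>j k. j < p \<Longrightarrow> k < p \<Longrightarrow> A j k = A k j"
  shows "vdot p u (mat_vec p A w) = vdot p w (mat_vec p A u)"
proof -
  have "vdot p u (mat_vec p A w) = (\<Sum>j<p. \<Sum>k<p. u j * A j k * w k)"
    by (simp add: vdot_def mat_vec_def sum_distrib_left mult.assoc)
  also have "\<dots> = (\<Sum>k<p. \<Sum>j<p. u j * A j k * w k)"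
    by (rule sum.swap)
  also have "\<dots> = vdot p w (mat_vec p A u)"
    using assms by (simp add: vdot_def mat_vec_def sum_distrib_left mult_ac)
  finally show ?thesis .
qed

lemma quadratic_nonpos_imp_linear_coeff_zero:
  fixes L q :: real
  assumes "\<And>t. 2 * t * L + t\<^sup>2 * q \<le> 0"
  shows "L = 0"
proof (rule ccontr)
  assume L: "L \<noteq> 0"
  \<comment> \<open>At \<open>t = L / d\<close> the linear term gains \<open>2 * L^2 / d\<close> and
    the quadratic term loses at most \<open>L^2 / d\<close>, so the value would be positive.\<close>
  define d where "d = 1 + \<bar>q\<bar>"
  have d: "d > 0" "q \<ge> - d" by (auto simp: d_def)
  have "2 * (L / d) * L + (L / d)\<^sup>2 * q \<ge> 2 * (L / d) * L - (L / d)\<^sup>2 * d"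
    using mult_left_mono[OF d(2), of "(L / d)\<^sup>2"] by simp
  also have "2 * (L / d) * L - (L / d)\<^sup>2 * d = L\<^sup>2 / d"
    using d(1) by (simp add: power2_eq_square field_simps)
  finally show False
    using assms[of "L / d"] L d(1) by (smt (verit) divide_pos_pos zero_less_power2)
qed

text \<open>The definition compares \<open>u\<close> only with other eigenvectors, so the maximum of
  the form on the sphere must be shown to be an eigenvalue. The first variation at a maximiser
  \<open>y\<close> does this without a spectral decomposition; the eigenvalue of \<open>u\<close>
  then dominates that maximum.\<close>

lemma top_unit_eigvec_maximizes_quadratic_form:
  assumes sym: "\<And>j k. j < p \<Longrightarrow> k < p \<Longrightarrow> A j k = A k j"
    and u: "is_top_unit_eigvec p A u"
    and w: "vnorm p w = 1"
  shows "vdot p w (mat_vec p A w) \<le> vdot p u (mat_vec p A u)"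
proof -
  define f where "f = (\<lambda>x. vdot p x (mat_vec p A x))"
  have "p > 0" using w by (cases p) (auto simp: vnorm_def)
  then obtain y where y: "vnorm p y = 1" and max: "\<And>x. vnorm p x = 1 \<Longrightarrow> f x \<le> f y"
    using quadratic_form_attains_max[of p A] unfolding f_def by blast
  have bound: "f x \<le> f y * vdot p x x" for x
  proof (cases "vnorm p x = 0")
    case True
    then show ?thesis by (simp add: vnorm_eq_0_iff f_def vdot_def)
  next
    case False
    define a where "a = 1 / vnorm p x"
    have a: "a > 0" using False vnorm_nonneg[of p x] by (simp add: a_def less_le)
    have "f (\<lambda>j. a * x j) \<le> f y"
      using a False by (intro max) (simp only: vnorm_scale, simp add: a_def)
    then have "a\<^sup>2 * f x \<le> f y"
      by (simp add: f_def mat_vec_scale vdot_linear power2_eq_square mult.assoc)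
    moreover have "a\<^sup>2 * vdot p x x = 1"
      using False by (simp add: a_def power_divide flip: vnorm_sq)
    ultimately have "a\<^sup>2 * f x \<le> a\<^sup>2 * (f y * vdot p x x)"
      by (simp add: mult.left_commute)
    then show ?thesis using a by simp
  qed
  define h where "h = (\<lambda>j. mat_vec p A y j - f y * y j)"
  have yy: "vdot p y y = 1" using y by (simp flip: vnorm_sq)
  have hh: "vdot p h h = vdot p h (mat_vec p A y) - f y * vdot p h y"
    by (subst (2) h_def) (simp add: vdot_linear)
  \<comment> \<open>Perturbing \<open>y\<close> along its own residual \<open>h\<close> makes the
    first-order coefficient the squared norm of \<open>h\<close>, which must therefore
    vanish.\<close>
  have "2 * t * vdot p h h + t\<^sup>2 * (f h - f y * vdot p h h) \<le> 0" for t
  proof -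
    have "f (\<lambda>j. y j + t * h j) = f y + 2 * t * vdot p h (mat_vec p A y) + t\<^sup>2 * f h"
      using vdot_mat_vec_commute[of p A y h, OF sym]
      by (simp add: f_def mat_vec_add mat_vec_scale vdot_linear power2_eq_square algebra_simps)
    moreover have "vdot p (\<lambda>j. y j + t * h j) (\<lambda>j. y j + t * h j) = 1 + 2 * t * vdot p h y + t\<^sup>2 * vdot p h h"
      by (simp add: vdot_linear yy vdot_commute[of p y h] power2_eq_square algebra_simps)
    ultimately have "f y + 2 * t * vdot p h (mat_vec p A y) + t\<^sup>2 * f h
        \<le> f y * (1 + 2 * t * vdot p h y + t\<^sup>2 * vdot p h h)"
      using bound[of "\<lambda>j. y j + t * h j"] by simp
    then show ?thesis by (subst (1) hh) (simp add: algebra_simps)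
  qed
  then have "vdot p h h = 0" by (rule quadratic_nonpos_imp_linear_coeff_zero)
  then have "\<forall>j<p. h j = 0" by (simp add: vnorm_eq_0_iff flip: vnorm_sq)
  moreover have "\<exists>j<p. y j \<noteq> 0"
    using y vnorm_eq_0_iff[of p y] by auto
  ultimately have "is_eigenpair p A (f y) y"
    by (simp add: is_eigenpair_def h_def)
  then obtain lam where lam: "is_eigenpair p A lam u" "f y \<le> lam" and nu: "vnorm p u = 1"
    using u by (auto simp: is_top_unit_eigvec_def)
  have "f u = vdot p u (\<lambda>j. lam * u j)"
    using lam(1) by (simp add: f_def vdot_def is_eigenpair_def)
  also have "\<dots> = lam" using nu by (simp add: vdot_linear flip: vnorm_sq)
  finally show ?thesis using max[OF w] lam(2) by (simp add: f_def)
qed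

section \<open>Deterministic perturbation bound for the top eigenvector\<close>

lemma vdot_mat_vec_sample_cov:
  "vdot p w (mat_vec p (sample_cov n p x) w) = (\<Sum>i<n. (vdot p (x i) w)\<^sup>2) / real n"
proof -
  have "vdot p w (mat_vec p (sample_cov n p x) w)
      = (\<Sum>j<p. \<Sum>k<p. \<Sum>i<n. (x i j * w j) * (x i k * w k)) / real n"
    by (simp add: vdot_def mat_vec_def sample_cov_def sum_distrib_left sum_distrib_right
        sum_divide_distrib mult_ac)
  also have "(\<Sum>j<p. \<Sum>k<p. \<Sum>i<n. (x i j * w j) * (x i k * w k))
      = (\<Sum>j<p. \<Sum>i<n. \<Sum>k<p. (x i j * w j) * (x i k * w k))"
    by (intro sum.cong refl sum.swap)
  also have "\<dots> = (\<Sum>i<n. \<Sum>j<p. \<Sum>k<p. (x i j * w j) * (x i k * w k))"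
    by (rule sum.swap)
  also have "\<dots> = (\<Sum>i<n. (vdot p (x i) w)\<^sup>2)"
    by (simp add: vdot_def power2_eq_square sum_product)
  finally show ?thesis .
qed

text \<open>Polarisation: \<open>Q u - Q e\<close> is the bilinear form of \<open>Q\<close> at
  \<open>u - e\<close> and \<open>u + e\<close>, whose norms multiply to \<open>2 * s\<close>. The
  resulting bound is linear in \<open>s\<close>, which is what allows a factor \<open>s\<close> to
  be cancelled against the signal term later.\<close>

lemma quadratic_form_diff_le:
  assumes K: "\<And>m. \<bar>(\<Sum>i<n. (vdot p (Z i) m)\<^sup>2) / real n - (vnorm p m)\<^sup>2\<bar> \<le> K * (vnorm p m)\<^sup>2"
    and u: "vnorm p u = 1" and e: "vnorm p e = 1"
    and s: "s > 0" "s\<^sup>2 = 1 - (vdot p u e)\<^sup>2"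
  shows "(\<Sum>i<n. (vdot p (Z i) u)\<^sup>2) / real n - (\<Sum>i<n. (vdot p (Z i) e)\<^sup>2) / real n \<le> 2 * K * s"
proof -
  define c where "c = vdot p u e"
  define Q where "Q = (\<lambda>m. (\<Sum>i<n. (vdot p (Z i) m)\<^sup>2) / real n - vdot p m m)"
  define x where "x = (\<lambda>j. u j - e j)"
  define y where "y = (\<lambda>j. u j + e j)"
  \<comment> \<open>This is the ratio of the norms of \<open>y\<close> and \<open>x\<close>, so
    \<open>a * x\<close> and \<open>y\<close> get equal norms and the parallelogram law loses
    nothing.\<close>
  define a where "a = 2 * s / (2 - 2 * c)"
  have uu: "vdot p u u = 1" and ee: "vdot p e e = 1"
    using u e by (simp_all flip: vnorm_sq)
  have s2: "s\<^sup>2 = (1 - c) * (1 + c)"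
    using s(2) by (simp add: c_def power2_eq_square algebra_simps)
  have c1: "c < 1"
  proof -
    have "c \<le> 1" using vdot_le_vnorm_mult[of p u e] u e by (simp add: c_def)
    moreover have "c \<noteq> 1" using s(1) s2 by auto
    ultimately show ?thesis by simp
  qed
  have a: "a > 0" "a * (2 - 2 * c) = 2 * s" using s(1) c1 by (auto simp: a_def)
  have yy: "2 + 2 * c = 2 * s * a"
    using s2 c1 by (simp add: a_def field_simps power2_eq_square)
  have par: "vdot p (\<lambda>j. a * x j + y j) (\<lambda>j. a * x j + y j)
      + vdot p (\<lambda>j. a * x j - y j) (\<lambda>j. a * x j - y j) = 8 * s * a"
  proof -
    have "vdot p (\<lambda>j. a * x j + y j) (\<lambda>j. a * x j + y j)
      + vdot p (\<lambda>j. a * x j - y j) (\<lambda>j. a * x j - y j) = 2 * a * (a * (2 - 2 * c)) + 2 * (2 + 2 * c)"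
      by (simp add: x_def y_def vdot_linear uu ee vdot_commute[of p e u] flip: c_def)
        (simp add: algebra_simps)
    then show ?thesis by (simp add: a(2) yy)
  qed
  have diff: "Q (\<lambda>j. a * x j + y j) - Q (\<lambda>j. a * x j - y j) = 4 * a * (Q u - Q e)"
  proof -
    have "(\<Sum>i<n. (vdot p (Z i) (\<lambda>j. a * x j + y j))\<^sup>2) - (\<Sum>i<n. (vdot p (Z i) (\<lambda>j. a * x j - y j))\<^sup>2)
      = 4 * a * ((\<Sum>i<n. (vdot p (Z i) u)\<^sup>2) - (\<Sum>i<n. (vdot p (Z i) e)\<^sup>2))"
      unfolding sum_subtractf[symmetric] sum_distrib_left
      by (intro sum.cong refl) (simp add: x_def y_def vdot_linear power2_eq_square algebra_simps)
    moreover have "vdot p (\<lambda>j. a * x j + y j) (\<lambda>j. a * x j + y j)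
      - vdot p (\<lambda>j. a * x j - y j) (\<lambda>j. a * x j - y j) = 4 * a * (vdot p u u - vdot p e e)"
      by (simp add: x_def y_def vdot_linear vdot_commute[of p e u] algebra_simps)
    ultimately show ?thesis
      by (simp add: Q_def algebra_simps flip: diff_divide_distrib add_divide_distrib)
  qed
  have K': "\<bar>Q m\<bar> \<le> K * vdot p m m" for m
    using K[of m] by (simp add: Q_def vnorm_sq)
  have "4 * a * (Q u - Q e) \<le> K * (8 * s * a)"
    using K'[of "\<lambda>j. a * x j + y j"] K'[of "\<lambda>j. a * x j - y j"]
    unfolding diff[symmetric] par[symmetric] by (simp add: distrib_left)
  then have "(4 * a) * (Q u - Q e) \<le> (4 * a) * (2 * K * s)" by (simp add: algebra_simps)
  then have "Q u - Q e \<le> 2 * K * s" using a(1) by simp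
  then show ?thesis by (simp add: Q_def uu ee)
qed

text \<open>Optimality of \<open>u\<close> against \<open>e\<close> yields
  \<open>A * r^2 * s^2\<close> on the left, while both noise contributions on the right are at most
  linear in \<open>s\<close>. Dividing by \<open>s\<close> gives the bound; for \<open>s = 0\<close>
  it is immediate.\<close>

lemma sin_angle_top_eigvec_le:
  fixes rho u :: "nat \<Rightarrow> real"
  assumes n: "n > 0" and sig: "\<sigma> > 0"
    and r: "vnorm p rho > 0"
    and u: "is_top_unit_eigvec p (sample_cov n p (\<lambda>i j. V i * rho j + \<sigma> * Z i j)) u"
    and K: "\<And>m. \<bar>(\<Sum>i<n. (vdot p (Z i) m)\<^sup>2) / real n - (vnorm p m)\<^sup>2\<bar> \<le> K * (vnorm p m)\<^sup>2"
    and K0: "K \<ge> 0"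
    and A: "(\<Sum>i<n. (V i)\<^sup>2) > 0"
  shows "sin_angle p u rho \<le>
    (2 * \<sigma> * vnorm p rho * vnorm p (\<lambda>j. (\<Sum>i<n. V i * Z i j) / real n) + 2 * \<sigma>\<^sup>2 * K)
      / ((\<Sum>i<n. (V i)\<^sup>2) / real n * (vnorm p rho)\<^sup>2)"
proof -
  define r where "r = vnorm p rho"
  define e where "e = (\<lambda>j. (1 / r) * rho j)"
  define c where "c = vdot p u e"
  define s where "s = sin_angle p u rho"
  define A where "A = (\<Sum>i<n. (V i)\<^sup>2) / real n"
  define b where "b = (\<lambda>j. (\<Sum>i<n. V i * Z i j) / real n)"
  define T where "T = (\<lambda>w. (\<Sum>i<n. (vdot p (Z i) w)\<^sup>2) / real n)"
  define x where "x = (\<lambda>i j. V i * rho j + \<sigma> * Z i j)"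
  have rpos: "r > 0" and Apos: "A > 0" using r n \<open>0 < sum _ _\<close> by (simp_all add: r_def A_def)
  have nu: "vnorm p u = 1" using u by (simp add: is_top_unit_eigvec_def)
  have ne: "vnorm p e = 1" unfolding e_def vnorm_scale using rpos by (simp add: r_def)
  have uu: "vdot p u u = 1" and ee: "vdot p e e = 1" using nu ne by (simp_all flip: vnorm_sq)
  have rho_dot: "vdot p rho w = r * vdot p e w" for w
    using rpos unfolding e_def vdot_scale_left by simp
  have c2: "c\<^sup>2 \<le> 1"
    using abs_vdot_le_vnorm_mult[of p u e] nu ne by (simp add: c_def abs_square_le_1)
  have s_eq: "s = sqrt (1 - c\<^sup>2)"
    using rho_dot[of u] rpos
    by (simp add: s_def sin_angle_def nu c_def vdot_commute[of p u] power_mult_distrib flip: r_def)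
  then have s2: "s\<^sup>2 = 1 - c\<^sup>2" and s0: "s \<ge> 0" using c2 by auto
  have b_dot: "vdot p b w = (\<Sum>i<n. V i * vdot p (Z i) w) / real n" for w
  proof -
    have "vdot p b w = (\<Sum>j<p. \<Sum>i<n. V i * (Z i j * w j)) / real n"
      by (simp add: vdot_def b_def sum_distrib_left sum_divide_distrib mult_ac)
    also have "(\<Sum>j<p. \<Sum>i<n. V i * (Z i j * w j)) = (\<Sum>i<n. \<Sum>j<p. V i * (Z i j * w j))"
      by (rule sum.swap)
    finally show ?thesis by (simp add: vdot_def sum_distrib_left)
  qed
  have R: "(\<Sum>i<n. (vdot p (x i) w)\<^sup>2) / real n
      = A * (r * vdot p e w)\<^sup>2 + 2 * \<sigma> * r * vdot p e w * vdot p b w + \<sigma>\<^sup>2 * T w" for w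
  proof -
    have "(\<Sum>i<n. (vdot p (x i) w)\<^sup>2) = (\<Sum>i<n. (V i)\<^sup>2 * (r * vdot p e w)\<^sup>2
        + 2 * \<sigma> * r * vdot p e w * (V i * vdot p (Z i) w) + \<sigma>\<^sup>2 * (vdot p (Z i) w)\<^sup>2)"
      by (intro sum.cong refl)
        (simp add: x_def vdot_linear rho_dot power2_eq_square algebra_simps)
    also have "\<dots> = (\<Sum>i<n. (V i)\<^sup>2) * (r * vdot p e w)\<^sup>2
        + 2 * \<sigma> * r * vdot p e w * (\<Sum>i<n. V i * vdot p (Z i) w) + \<sigma>\<^sup>2 * (\<Sum>i<n. (vdot p (Z i) w)\<^sup>2)"
      by (simp only: sum.distrib flip: sum_distrib_left sum_distrib_right)
    finally show ?thesis
      by (simp add: A_def T_def b_dot add_divide_distrib)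
  qed
  have "(\<Sum>i<n. (vdot p (x i) e)\<^sup>2) / real n \<le> (\<Sum>i<n. (vdot p (x i) u)\<^sup>2) / real n"
    using top_unit_eigvec_maximizes_quadratic_form[OF _ u ne]
    by (simp add: vdot_mat_vec_sample_cov x_def sample_cov_def mult.commute)
  then have main: "A * r\<^sup>2 + 2 * \<sigma> * r * vdot p b e + \<sigma>\<^sup>2 * T e
      \<le> A * r\<^sup>2 * c\<^sup>2 + 2 * \<sigma> * r * c * vdot p b u + \<sigma>\<^sup>2 * T u"
    by (simp add: R ee c_def vdot_commute[of p e u] power_mult_distrib mult.assoc)
  have "s * (A * r\<^sup>2) \<le> 2 * \<sigma> * r * vnorm p b + 2 * \<sigma>\<^sup>2 * K"
  proof (cases "s = 0")
    case True
    then show ?thesis using sig rpos K0 by simp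
  next
    case False
    then have spos: "s > 0" using s0 by simp
    have T: "T u - T e \<le> 2 * K * s"
      unfolding T_def by (rule quadratic_form_diff_le[OF K nu ne spos]) (simp add: s2 c_def)
    \<comment> \<open>Up to sign, \<open>c * u - e\<close> is the component of \<open>e\<close>
      orthogonal to \<open>u\<close>, so its norm is the sine; Cauchy-Schwarz against
      \<open>b\<close> then produces the factor \<open>s\<close>.\<close>
    have "vdot p (\<lambda>j. c * u j - e j) (\<lambda>j. c * u j - e j) = s\<^sup>2"
      using s2 by (simp add: vdot_linear uu ee vdot_commute[of p e u] power2_eq_square flip: c_def)
    then have "vnorm p (\<lambda>j. c * u j - e j) = s"
      using s0 by (metis vnorm_sq power2_eq_imp_eq vnorm_nonneg)
    then have B: "c * vdot p b u - vdot p b e \<le> vnorm p b * s"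
      using vdot_le_vnorm_mult[of p b "\<lambda>j. c * u j - e j"] by (simp add: vdot_linear)
    have "A * r\<^sup>2 * s\<^sup>2 \<le> 2 * \<sigma> * r * (c * vdot p b u - vdot p b e) + \<sigma>\<^sup>2 * (T u - T e)"
      using main by (simp add: s2 algebra_simps)
    also have "\<dots> \<le> 2 * \<sigma> * r * (vnorm p b * s) + \<sigma>\<^sup>2 * (2 * K * s)"
      using B T sig rpos by (intro add_mono mult_left_mono) auto
    finally have "s * (s * (A * r\<^sup>2)) \<le> s * (2 * \<sigma> * r * vnorm p b + 2 * \<sigma>\<^sup>2 * K)"
      by (simp add: power2_eq_square algebra_simps)
    then show ?thesis using spos by simp
  qed
  then have "s \<le> (2 * \<sigma> * r * vnorm p b + 2 * \<sigma>\<^sup>2 * K) / (A * r\<^sup>2)"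
    using Apos rpos by (simp add: pos_le_divide_eq)
  then show ?thesis by (simp add: s_def r_def A_def b_def)
qed

section \<open>An integer net for the quadratic form\<close>

lemma vdot_cong:
  "(\<And>j. j < p \<Longrightarrow> u j = u' j) \<Longrightarrow> (\<And>j. j < p \<Longrightarrow> w j = w' j) \<Longrightarrow> vdot p u w = vdot p u' w'"
  by (simp add: vdot_def)

lemma vdot_fun_upd:
  assumes "j < p"
  shows "vdot p x (m(j := m j + h)) = vdot p x m + h * x j"
proof -
  have "vdot p x (m(j := m j + h)) = (\<Sum>k<p. x k * m k + (if k = j then h * x k else 0))"
    unfolding vdot_def by (intro sum.cong) (auto simp: algebra_simps)
  also have "\<dots> = vdot p x m + h * x j"
    using assms by (simp add: sum.distrib vdot_def)
  finally show ?thesis .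
qed

text \<open>Derandomised unbiased rounding: a coordinate \<open>y\<close> with fractional part \<open>d\<close> is rounded up
  with probability \<open>d\<close>; the expected change of a quadratic with leading coefficient \<open>q\<close> is
  then \<open>q * d * (1 - d) \<ge> - t / 2\<close>.\<close>

lemma coordinatewise_rounding:
  fixes f :: "(nat \<Rightarrow> real) \<Rightarrow> real"
  assumes quad: "\<And>m j. j < p \<Longrightarrow> \<exists>b q. q \<ge> - 2 * t \<and> (\<forall>h. f (m(j := m j + h)) = f m + b * h + q * h\<^sup>2)"
    and t: "t \<ge> 0"
    and k: "k \<le> p"
  shows "\<exists>m. (\<forall>j<k. m j \<in> \<int> \<and> \<bar>m j - U j\<bar> \<le> 1) \<and> (\<forall>j\<ge>k. m j = U j) \<and> f m \<ge> f U - real k * (t / 2)"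
  using k
proof (induction k)
  case 0
  then show ?case by (intro exI[of _ U]) auto
next
  case (Suc k)
  then obtain m where m: "\<forall>j<k. m j \<in> \<int> \<and> \<bar>m j - U j\<bar> \<le> 1" "\<forall>j\<ge>k. m j = U j"
    "f m \<ge> f U - real k * (t / 2)"
    by auto
  obtain b q where q: "q \<ge> - 2 * t" and f: "\<And>h. f (m(k := m k + h)) = f m + b * h + q * h\<^sup>2"
    using quad[of k m] Suc.prems by auto
  define d where "d = m k - of_int \<lfloor>m k\<rfloor>"
  have d: "0 \<le> d" "d < 1" unfolding d_def by linarith+
  have "(1 - d) * f (m(k := m k + - d)) + d * f (m(k := m k + (1 - d))) = f m + q * (d * (1 - d))"
    unfolding f by (simp add: power2_eq_square algebra_simps)
  moreover have "q * (d * (1 - d)) \<ge> - (t / 2)"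
  proof -
    have "d * (1 - d) \<le> 1 / 4"
      using zero_le_power2[of "d - 1 / 2"] by (simp add: power2_eq_square algebra_simps)
    moreover have "0 \<le> d * (1 - d)" using d by simp
    ultimately have "- 2 * t * (d * (1 - d)) \<ge> - 2 * t * (1 / 4)"
      using t by (intro mult_left_mono_neg) auto
    moreover have "q * (d * (1 - d)) \<ge> - 2 * t * (d * (1 - d))"
      using q \<open>0 \<le> d * (1 - d)\<close> by (rule mult_right_mono)
    ultimately show ?thesis by simp
  qed
  ultimately have avg: "(1 - d) * f (m(k := m k + - d)) + d * f (m(k := m k + (1 - d))) \<ge> f m - t / 2"
    by simp
  have "\<exists>h\<in>{- d, 1 - d}. f (m(k := m k + h)) \<ge> f m - t / 2"
  proof (rule ccontr)
    assume "\<not> ?thesis"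
    then have "f (m(k := m k + - d)) < f m - t / 2" "f (m(k := m k + (1 - d))) < f m - t / 2"
      by auto
    then have "(1 - d) * f (m(k := m k + - d)) + d * f (m(k := m k + (1 - d)))
        < (1 - d) * (f m - t / 2) + d * (f m - t / 2)"
      using d by (intro add_less_le_mono mult_strict_left_mono mult_left_mono) auto
    also have "\<dots> = f m - t / 2" by (simp add: field_simps)
    finally show False using avg by simp
  qed
  then obtain h where h: "h \<in> {- d, 1 - d}" and fh: "f (m(k := m k + h)) \<ge> f m - t / 2" by blast
  define m' where "m' = m(k := m k + h)"
  have "m k + h \<in> \<int>" using h by (auto simp: d_def)
  moreover have "\<bar>h\<bar> \<le> 1" using h d by auto
  ultimately have "\<forall>j<Suc k. m' j \<in> \<int> \<and> \<bar>m' j - U j\<bar> \<le> 1" "\<forall>j\<ge>Suc k. m' j = U j"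
    using m(1,2) by (auto simp: less_Suc_eq m'_def)
  moreover have "f m' \<ge> f U - real (Suc k) * (t / 2)"
    using fh m(3) unfolding m'_def by (simp add: algebra_simps add_divide_distrib)
  ultimately show ?case by blast
qed

text \<open>The penalised form \<open>f\<close> is nonpositive on the net. Rounding a vector
  \<open>U\<close> of norm \<open>2 * sqrt p\<close> moves it by at most \<open>sqrt p\<close>,
  hence stays in the ball of radius \<open>3 * sqrt p\<close>, and costs at most
  \<open>p * t / 2\<close>. So the signed form at \<open>U\<close> is at most
  \<open>4 * p * t + p * t / 2\<close>, which is \<open>9 / 8 * t\<close> times the squared norm
  \<open>4 * p\<close>.\<close>

lemma quadratic_form_bound_from_integer_net:
  fixes Z :: "nat \<Rightarrow> nat \<Rightarrow> real"
  assumes net: "\<And>m. (\<And>j. j < p \<Longrightarrow> m j \<in> \<int>) \<Longrightarrow> vdot p m m \<le> 9 * real p \<Longrightarrow>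
      \<bar>(\<Sum>i<n. (vdot p (Z i) m)\<^sup>2) / real n - vdot p m m\<bar> \<le> t * vdot p m m"
    and t: "t \<ge> 0"
  shows "\<bar>(\<Sum>i<n. (vdot p (Z i) w)\<^sup>2) / real n - vdot p w w\<bar> \<le> 9 / 8 * t * vdot p w w"
proof (cases "vnorm p w = 0")
  case True
  then have "vdot p x w = 0" for x by (simp add: vnorm_eq_0_iff vdot_def)
  then show ?thesis by simp
next
  case False
  then have p: "p > 0" by (cases p) (auto simp: vnorm_def)
  define Q where "Q = (\<lambda>m. (\<Sum>i<n. (vdot p (Z i) m)\<^sup>2) / real n - vdot p m m)"
  have signed: "\<epsilon> * Q w \<le> 9 / 8 * t * vdot p w w" if \<epsilon>: "\<epsilon> \<in> {1, -1}" for \<epsilon> :: real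
  proof -
    define f where "f = (\<lambda>m. \<epsilon> * Q m - t * vdot p m m)"
    define a where "a = 2 * sqrt (real p) / vnorm p w"
    define U where "U = (\<lambda>j. a * w j)"
    have le: "\<epsilon> * x \<le> \<bar>x\<bar>" for x using \<epsilon> by auto
    have quad: "\<exists>b q. q \<ge> - 2 * t \<and> (\<forall>h. f (m(j := m j + h)) = f m + b * h + q * h\<^sup>2)" if j: "j < p" for m j
    proof (intro exI conjI allI)
      let ?q = "\<epsilon> * ((\<Sum>i<n. (Z i j)\<^sup>2) / real n - 1) - t"
      let ?b = "\<epsilon> * (2 * (\<Sum>i<n. vdot p (Z i) m * Z i j) / real n - 2 * m j) - t * (2 * m j)"
      \<comment> \<open>Coordinate vectors are integer points of the ball, so the net hypothesis
        itself controls the diagonal entries and thus the leading coefficient.\<close>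
      define e where "e = (\<lambda>k. if k = j then 1 else 0 :: real)"
      have e: "vdot p x e = x j" for x using j by (simp add: vdot_def e_def if_distrib[of "(*) _"] cong: if_cong)
      have "\<bar>(\<Sum>i<n. (Z i j)\<^sup>2) / real n - 1\<bar> \<le> t"
        using net[of e] p unfolding e by (auto simp: e_def)
      then show "?q \<ge> - 2 * t" using \<epsilon> by auto
      fix h
      have "(\<Sum>i<n. (vdot p (Z i) (m(j := m j + h)))\<^sup>2)
          = (\<Sum>i<n. (vdot p (Z i) m)\<^sup>2) + 2 * h * (\<Sum>i<n. vdot p (Z i) m * Z i j) + h\<^sup>2 * (\<Sum>i<n. (Z i j)\<^sup>2)"
        unfolding sum_distrib_left sum.distrib[symmetric]
        by (intro sum.cong refl) (simp only: vdot_fun_upd[OF j], simp add: power2_eq_square algebra_simps)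
      moreover have "vdot p (m(j := m j + h)) (m(j := m j + h)) = vdot p m m + 2 * h * m j + h\<^sup>2"
        using vdot_fun_upd[OF j, of "m(j := m j + h)" m h] vdot_fun_upd[OF j, of m m h]
          vdot_commute[of p m "m(j := m j + h)"]
        by (simp add: power2_eq_square algebra_simps)
      ultimately show "f (m(j := m j + h)) = f m + ?b * h + ?q * h\<^sup>2"
        by (simp add: f_def Q_def add_divide_distrib algebra_simps)
    qed
    obtain m where m: "\<forall>j<p. m j \<in> \<int> \<and> \<bar>m j - U j\<bar> \<le> 1" and fm: "f m \<ge> f U - real p * (t / 2)"
      using coordinatewise_rounding[of p t f p U, OF quad t] by auto
    have U: "vnorm p U = 2 * sqrt (real p)"
      using False vnorm_nonneg[of p w] unfolding U_def vnorm_scale by (simp add: a_def)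
    have "vnorm p (\<lambda>j. m j - U j) \<le> sqrt (\<Sum>j<p. 1)"
      unfolding vnorm_def using m by (intro real_sqrt_le_mono sum_mono) (auto simp: abs_square_le_1)
    then have "vnorm p m \<le> 3 * sqrt (real p)"
      using vnorm_triangle[of p U "\<lambda>j. m j - U j"] U by simp
    then have "(vnorm p m)\<^sup>2 \<le> (3 * sqrt (real p))\<^sup>2"
      by (intro power_mono) auto
    then have "vdot p m m \<le> 9 * real p"
      by (simp add: power_mult_distrib vnorm_sq)
    then have "f m \<le> 0"
      using net[of m] m le[of "Q m"] by (auto simp: f_def Q_def)
    then have "\<epsilon> * Q U \<le> t * vdot p U U + real p * (t / 2)"
      using fm by (simp add: f_def)
    also have "vdot p U U = 4 * real p"
      using U by (simp add: power_mult_distrib flip: vnorm_sq)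
    finally have *: "\<epsilon> * Q U \<le> 9 / 2 * t * real p" by (simp add: algebra_simps)
    have "Q U = a\<^sup>2 * Q w"
      by (simp add: Q_def U_def vdot_linear power_mult_distrib algebra_simps power2_eq_square
          flip: sum_distrib_left)
    moreover have ap: "a\<^sup>2 * vdot p w w = 4 * real p"
      using False by (simp add: a_def power_divide power_mult_distrib flip: vnorm_sq)
    ultimately have "a\<^sup>2 * (\<epsilon> * Q w) \<le> a\<^sup>2 * (9 / 8 * t * vdot p w w)"
      using * by (simp add: mult.left_commute mult.assoc)
    moreover have "a\<^sup>2 > 0" using False p by (simp add: a_def)
    ultimately show ?thesis by (simp only: mult_le_cancel_left_pos)
  qed
  have "\<bar>Q w\<bar> \<le> 9 / 8 * t * vdot p w w"
    using signed[of 1] signed[of "-1"] by (intro abs_leI) auto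
  then show ?thesis by (simp only: Q_def)
qed

text \<open>The box follows from the norm constraint on the coordinates below \<open>p\<close>;
  together with extensionality it exhibits the set as a subset of a finite product. The squares are
  natural numbers so that they can serve as exponents in the counting argument.\<close>

definition int_net :: "nat \<Rightarrow> (nat \<Rightarrow> int) set" where
  "int_net p = {m \<in> PiE {..<p} (\<lambda>_. {- 9 * int p..9 * int p}). (\<Sum>j<p. (nat \<bar>m j\<bar>)\<^sup>2) \<le> 9 * p}"

lemma finite_int_net: "finite (int_net p)"
  unfolding int_net_def by (rule finite_subset[of _ "PiE {..<p} (\<lambda>_. {- 9 * int p..9 * int p})"])
    (auto intro!: finite_PiE)

lemma int_net_represents:
  fixes m :: "nat \<Rightarrow> real"
  assumes int: "\<And>j. j < p \<Longrightarrow> m j \<in> \<int>" and le: "vdot p m m \<le> 9 * real p"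
  obtains k where "k \<in> int_net p" and "\<And>j. j < p \<Longrightarrow> m j = of_int (k j)"
proof
  define k where "k = restrict (\<lambda>j. \<lfloor>m j\<rfloor>) {..<p}"
  show mk: "m j = of_int (k j)" if "j < p" for j
    using int[OF that] that by (auto simp: k_def elim!: Ints_cases)
  have "real (\<Sum>j<p. (nat \<bar>k j\<bar>)\<^sup>2) = vdot p m m"
    unfolding vdot_def of_nat_sum
    by (intro sum.cong refl) (simp add: mk power2_eq_square)
  then have "real (\<Sum>j<p. (nat \<bar>k j\<bar>)\<^sup>2) \<le> real (9 * p)" using le by simp
  then have sum: "(\<Sum>j<p. (nat \<bar>k j\<bar>)\<^sup>2) \<le> 9 * p" by (simp only: of_nat_le_iff)
  have "k j \<in> {- 9 * int p..9 * int p}" if "j < p" for j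
  proof -
    have "nat \<bar>k j\<bar> \<le> (nat \<bar>k j\<bar>)\<^sup>2" by (simp add: power2_nat_le_imp_le self_le_power)
    also have "\<dots> \<le> (\<Sum>j<p. (nat \<bar>k j\<bar>)\<^sup>2)"
      using that by (intro member_le_sum) auto
    finally show ?thesis using sum by auto
  qed
  then show "k \<in> int_net p"
    using sum by (auto simp: int_net_def k_def)
qed

text \<open>\<open>18 / 19\<close> is a rational stand-in for \<open>exp (- 1 / 18)\<close>, the near-optimal Chernoff weight for
  counting integer points of squared norm at most \<open>9 p\<close>.\<close>

lemma gaussian_weight_sum_le:
  "(\<Sum>k\<in>{- int B..int B}. (18 / 19 :: real) ^ ((nat \<bar>k\<bar>)\<^sup>2)) \<le> 41 / 5"
proof -
  define r :: real where "r = 18 / 19"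
  define S where "S = (\<lambda>B. \<Sum>k\<in>{- int B..int B}. r ^ ((nat \<bar>k\<bar>)\<^sup>2))"
  have step: "S (Suc B) = S B + 2 * r ^ ((Suc B)\<^sup>2)" for B
  proof -
    have "{- int (Suc B)..int (Suc B)} = insert (int (Suc B)) (insert (- int (Suc B)) {- int B..int B})"
      by auto
    then have "S (Suc B) = r ^ ((nat \<bar>int (Suc B)\<bar>)\<^sup>2) + (r ^ ((nat \<bar>- int (Suc B)\<bar>)\<^sup>2) + S B)"
      unfolding S_def by (simp del: of_nat_Suc)
    moreover have "nat \<bar>- int (Suc B)\<bar> = Suc B" "nat \<bar>int (Suc B)\<bar> = Suc B" by auto
    ultimately show ?thesis by simp
  qed
  have r: "0 < r" "r < 1" by (auto simp: r_def)
  have r6: "r ^ 6 < 1" using r by (simp add: power_less_one_iff)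
  have S5: "S 5 = 1 + 2 * (r + r ^ 4 + r ^ 9 + r ^ 16 + r ^ 25)"
  proof -
    have "S 0 = 1" by (simp add: S_def)
    then show ?thesis
      using step[of 0] step[of 1] step[of 2] step[of 3] step[of 4] by (simp add: numeral_eq_Suc)
  qed
  \<comment> \<open>For \<open>k \<ge> 6\<close> the weight \<open>r ^ (k^2)\<close> is at most
    \<open>r ^ (6 * k)\<close>. Carrying the remaining geometric series in the claim makes the
    induction close with a bound independent of \<open>i\<close>.\<close>
  have tail: "S (5 + i) + 2 * r ^ (6 * (6 + i)) / (1 - r ^ 6) \<le> 41 / 5" for i
  proof (induction i)
    case 0
    show ?case unfolding add_0_right S5 by (simp add: r_def power_divide)
  next
    case (Suc i)
    have "r ^ ((6 + i)\<^sup>2) \<le> r ^ (6 * (6 + i))"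
      using r by (intro power_decreasing) (auto simp: power2_eq_square algebra_simps)
    moreover have "r ^ (6 * (6 + Suc i)) / (1 - r ^ 6) = r ^ (6 * (6 + i)) / (1 - r ^ 6) - r ^ (6 * (6 + i))"
      using r6 by (simp add: field_simps flip: power_add)
    ultimately show ?case
      using Suc.IH step[of "5 + i"] by simp
  qed
  have "S B \<le> S (5 + B)"
    unfolding S_def using r by (intro sum_mono2) auto
  also have "\<dots> \<le> 41 / 5"
    using tail[of B] r r6 by (smt (verit) divide_nonneg_nonneg zero_le_power)
  finally show ?thesis by (simp add: S_def r_def)
qed

text \<open>Each net point has weight at least \<open>r ^ (9 * p)\<close>, and the total weight over
  the box factorises into one-dimensional sums.\<close>

lemma card_int_net_le: "real (card (int_net p)) \<le> (27 / 2) ^ p"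
proof -
  define r :: real where "r = 18 / 19"
  define P where "P = PiE {..<p} (\<lambda>_. {- 9 * int p..9 * int p})"
  have r: "0 < r" "r < 1" by (auto simp: r_def)
  have "real (card (int_net p)) * r ^ (9 * p) = (\<Sum>m\<in>int_net p. r ^ (9 * p))"
    by simp
  also have "\<dots> \<le> (\<Sum>m\<in>int_net p. r ^ (\<Sum>j<p. (nat \<bar>m j\<bar>)\<^sup>2))"
    using r by (intro sum_mono power_decreasing) (auto simp: int_net_def)
  also have "\<dots> \<le> (\<Sum>m\<in>P. r ^ (\<Sum>j<p. (nat \<bar>m j\<bar>)\<^sup>2))"
    using r by (intro sum_mono2) (auto simp: P_def int_net_def intro!: finite_PiE)
  also have "\<dots> = (\<Sum>m\<in>P. \<Prod>j<p. r ^ ((nat \<bar>m j\<bar>)\<^sup>2))"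
    by (simp add: power_sum)
  also have "\<dots> = (\<Prod>j<p. \<Sum>k\<in>{- 9 * int p..9 * int p}. r ^ ((nat \<bar>k\<bar>)\<^sup>2))"
    unfolding P_def by (rule prod_sum_PiE[symmetric]) auto
  also have "\<dots> \<le> (\<Prod>j<p. 41 / 5)"
    using r gaussian_weight_sum_le[of "9 * p"]
    by (intro prod_mono) (auto simp: r_def intro!: sum_nonneg)
  \<comment> \<open>The base \<open>27 / 2\<close> is chosen just large enough for
    \<open>41 / 5 \<le> 27 / 2 * (18 / 19) ^ 9\<close>.\<close>
  also have "\<dots> \<le> (27 / 2 * r ^ 9) ^ p"
    unfolding prod_constant card_lessThan by (rule power_mono) (simp_all add: r_def power_divide)
  also have "\<dots> = (27 / 2) ^ p * r ^ (9 * p)"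
    by (simp only: power_mult_distrib power_mult)
  finally show ?thesis using r by simp
qed

text \<open>Puts the net size in exponential form, ready to be absorbed by a tail bound. The
  quadratic Taylor bound is too weak at \<open>8 / 3\<close>, so it is taken at \<open>1 / 3\<close>
  and raised to the eighth power.\<close>

lemma exp_eight_thirds_ge: "27 / 2 \<le> exp (8 / 3 :: real)"
proof -
  have "(1 + 1 / 3 + (1 / 3)\<^sup>2 / 2 :: real) \<le> exp (1 / 3)"
    by (rule exp_lower_Taylor_quadratic) simp
  then have "(25 / 18 :: real) ^ 8 \<le> exp (1 / 3) ^ 8"
    by (intro power_mono) (auto simp: power2_eq_square)
  also have "\<dots> = exp (8 / 3)" by (simp flip: exp_of_nat_mult)
  finally show ?thesis by (simp add: power_divide)
qed

section \<open>Gaussian arrays\<close>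

context prob_space
begin

lemma std_normal_linear_combination:
  fixes X :: "'i \<Rightarrow> 'a \<Rightarrow> real" and a :: "'i \<Rightarrow> real"
  assumes fin: "finite I"
    and ind: "indep_vars (\<lambda>_. borel) X I"
    and dist: "\<And>i. i \<in> I \<Longrightarrow> distributed M lborel (X i) std_normal_density"
    and S: "(\<Sum>i\<in>I. (a i)\<^sup>2) > 0"
  shows "distributed M lborel (\<lambda>\<omega>. (\<Sum>i\<in>I. a i * X i \<omega>) / sqrt (\<Sum>i\<in>I. (a i)\<^sup>2)) std_normal_density"
proof -
  \<comment> \<open>Terms with zero coefficient are dropped because a normal variable of variance 0
    has no density.\<close>
  define J where "J = {i \<in> I. a i \<noteq> 0}"
  have J: "J \<subseteq> I" "finite J" using fin by (auto simp: J_def)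
  have sumJ: "(\<Sum>i\<in>I. a i * X i \<omega>) = (\<Sum>i\<in>J. a i * X i \<omega>)" for \<omega>
    using fin by (intro sum.mono_neutral_right) (auto simp: J_def)
  have sqJ: "(\<Sum>i\<in>I. (a i)\<^sup>2) = (\<Sum>i\<in>J. (a i)\<^sup>2)"
    using fin by (intro sum.mono_neutral_right) (auto simp: J_def)
  have "J \<noteq> {}" using S sqJ by auto
  moreover have "indep_vars (\<lambda>_. borel) (\<lambda>i \<omega>. a i * X i \<omega>) J"
    by (rule indep_vars_compose2[OF indep_vars_subset[OF ind J(1)]]) measurable
  moreover have "distributed M lborel (\<lambda>\<omega>. a i * X i \<omega>) (normal_density 0 \<bar>a i\<bar>)" if "i \<in> J" for i
    using normal_density_affine[OF dist, of i "a i" 0] that by (auto simp: J_def)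
  ultimately have "distributed M lborel (\<lambda>\<omega>. \<Sum>i\<in>J. a i * X i \<omega>)
      (normal_density (\<Sum>i\<in>J. 0) (sqrt (\<Sum>i\<in>J. \<bar>a i\<bar>\<^sup>2)))"
    using J(2) by (intro sum_indep_normal) (auto simp: J_def)
  then show ?thesis
    using S normal_standard_normal_convert[of "sqrt (\<Sum>i\<in>J. (a i)\<^sup>2)" "\<lambda>\<omega>. \<Sum>i\<in>J. a i * X i \<omega>" 0]
    by (simp add: sumJ sqJ)
qed

text \<open>By injectivity of \<open>g\<close> the blocks use disjoint sets of variables, hence are
  independent. Leaving \<open>g\<close> abstract covers sums along rows, along columns and over
  single entries alike.\<close>

lemma std_normal_block_sums:
  fixes X :: "'i \<Rightarrow> 'a \<Rightarrow> real" and g :: "'l \<Rightarrow> 't \<Rightarrow> 'i" and a :: "'t \<Rightarrow> real"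
  assumes fin: "finite T"
    and ind: "indep_vars (\<lambda>_. borel) X UNIV"
    and dist: "\<And>i. distributed M lborel (X i) std_normal_density"
    and inj: "\<And>l t l' t'. g l t = g l' t' \<Longrightarrow> l = l' \<and> t = t'"
    and S: "(\<Sum>t\<in>T. (a t)\<^sup>2) > 0"
  defines "Y \<equiv> \<lambda>l \<omega>. (\<Sum>t\<in>T. a t * X (g l t) \<omega>) / sqrt (\<Sum>t\<in>T. (a t)\<^sup>2)"
  shows "indep_vars (\<lambda>_. borel) Y L"
    and "distributed M lborel (Y l) std_normal_density"
proof -
  have "indep_vars (\<lambda>l. PiM (g l ` T) (\<lambda>_. borel)) (\<lambda>l \<omega>. restrict (\<lambda>i. X i \<omega>) (g l ` T)) L"
    by (rule indep_vars_restrict[OF ind]) (auto simp: disjoint_family_on_def dest: inj)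
  then have "indep_vars (\<lambda>_. borel) (\<lambda>l \<omega>. (\<lambda>\<xi>. (\<Sum>t\<in>T. a t * \<xi> (g l t)) / sqrt (\<Sum>t\<in>T. (a t)\<^sup>2))
      (restrict (\<lambda>i. X i \<omega>) (g l ` T))) L"
    by (rule indep_vars_compose2)
      (intro borel_measurable_divide borel_measurable_sum borel_measurable_times borel_measurable_const
        measurable_component_singleton, auto)
  then show "indep_vars (\<lambda>_. borel) Y L"
    by (simp add: Y_def)
  have inj_g: "inj_on (g l) T" using inj by (auto simp: inj_on_def)
  have "distributed M lborel (\<lambda>\<omega>. (\<Sum>i\<in>g l ` T. a (inv_into T (g l) i) * X i \<omega>)
      / sqrt (\<Sum>i\<in>g l ` T. (a (inv_into T (g l) i))\<^sup>2)) std_normal_density"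
  proof (rule std_normal_linear_combination)
    show "indep_vars (\<lambda>_. borel) X (g l ` T)" by (rule indep_vars_subset[OF ind]) simp
    show "(\<Sum>i\<in>g l ` T. (a (inv_into T (g l) i))\<^sup>2) > 0" using S inj_g by (simp add: sum.reindex)
  qed (use fin dist in simp_all)
  then show "distributed M lborel (Y l) std_normal_density"
    using inj_g by (simp add: Y_def sum.reindex)
qed

text \<open>Multiplying by the sum of squares instead of dividing, with a strict inequality, keeps
  the bound valid when all weights vanish: the event then reads \<open>0 < 0\<close>. This matters
  when the weights are frozen values of random variables.\<close>

lemma std_normal_block_sums_upper_tail:
  fixes X :: "'i \<Rightarrow> 'a \<Rightarrow> real" and g :: "'l \<Rightarrow> 't \<Rightarrow> 'i" and a :: "'t \<Rightarrow> real"
  assumes fin: "finite T" "finite L" "L \<noteq> {}"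
    and ind: "indep_vars (\<lambda>_. borel) X UNIV"
    and dist: "\<And>i. distributed M lborel (X i) std_normal_density"
    and inj: "\<And>l t l' t'. g l t = g l' t' \<Longrightarrow> l = l' \<and> t = t'"
    and x: "x \<ge> 0"
  shows "prob {\<omega> \<in> space M. (\<Sum>t\<in>T. (a t)\<^sup>2) * (real (card L) + 2 * sqrt (real (card L) * x) + 2 * x)
      < (\<Sum>l\<in>L. (\<Sum>t\<in>T. a t * X (g l t) \<omega>)\<^sup>2)} \<le> exp (- x)"
proof (cases "(\<Sum>t\<in>T. (a t)\<^sup>2) = 0")
  case True
  then have "\<forall>t\<in>T. a t = 0" using fin by (simp add: sum_nonneg_eq_0_iff)
  then show ?thesis using True by simp
next
  case False
  define S where "S = (\<Sum>t\<in>T. (a t)\<^sup>2)"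
  have S: "S > 0" using False by (simp add: S_def less_le sum_nonneg)
  have [measurable]: "X i \<in> borel_measurable M" for i
    using ind by (auto simp: indep_vars_def)
  define Y where "Y = (\<lambda>l \<omega>. (\<Sum>t\<in>T. a t * X (g l t) \<omega>) / sqrt S)"
  have Y: "indep_vars (\<lambda>_. borel) Y L" "\<And>l. distributed M lborel (Y l) std_normal_density"
    unfolding Y_def S_def by (rule std_normal_block_sums[OF fin(1) ind dist inj S[unfolded S_def]], assumption)+
  have "prob {\<omega> \<in> space M. S * (real (card L) + 2 * sqrt (real (card L) * x) + 2 * x)
      < (\<Sum>l\<in>L. (\<Sum>t\<in>T. a t * X (g l t) \<omega>)\<^sup>2)}
    \<le> prob {\<omega> \<in> space M. real (card L) + 2 * sqrt (real (card L) * x) + 2 * x \<le> (\<Sum>l\<in>L. (Y l \<omega>)\<^sup>2)}"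
  proof (rule finite_measure_mono)
    show "{\<omega> \<in> space M. real (card L) + 2 * sqrt (real (card L) * x) + 2 * x \<le> (\<Sum>l\<in>L. (Y l \<omega>)\<^sup>2)} \<in> events"
      unfolding Y_def by measurable
    show "{\<omega> \<in> space M. S * (real (card L) + 2 * sqrt (real (card L) * x) + 2 * x)
      < (\<Sum>l\<in>L. (\<Sum>t\<in>T. a t * X (g l t) \<omega>)\<^sup>2)}
      \<subseteq> {\<omega> \<in> space M. real (card L) + 2 * sqrt (real (card L) * x) + 2 * x \<le> (\<Sum>l\<in>L. (Y l \<omega>)\<^sup>2)}"
      using S by (auto simp: Y_def power_divide pos_le_divide_eq mult.commute simp flip: sum_divide_distrib)
  qed
  also have "\<dots> \<le> exp (- x)"
    by (rule std_normal_sum_squares_upper_tail[OF fin(2,3) Y x])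
  finally show ?thesis by (simp add: S_def)
qed

lemma std_normal_block_sums_lower_tail:
  fixes X :: "'i \<Rightarrow> 'a \<Rightarrow> real" and g :: "'l \<Rightarrow> 't \<Rightarrow> 'i" and a :: "'t \<Rightarrow> real"
  assumes fin: "finite T" "finite L" "L \<noteq> {}"
    and ind: "indep_vars (\<lambda>_. borel) X UNIV"
    and dist: "\<And>i. distributed M lborel (X i) std_normal_density"
    and inj: "\<And>l t l' t'. g l t = g l' t' \<Longrightarrow> l = l' \<and> t = t'"
    and x: "x \<ge> 0"
  shows "prob {\<omega> \<in> space M. (\<Sum>l\<in>L. (\<Sum>t\<in>T. a t * X (g l t) \<omega>)\<^sup>2)
      < (\<Sum>t\<in>T. (a t)\<^sup>2) * (real (card L) - 2 * sqrt (real (card L) * x))} \<le> exp (- x)"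
proof (cases "(\<Sum>t\<in>T. (a t)\<^sup>2) = 0")
  case True
  then have "\<forall>t\<in>T. a t = 0" using fin by (simp add: sum_nonneg_eq_0_iff)
  then show ?thesis using True by simp
next
  case False
  define S where "S = (\<Sum>t\<in>T. (a t)\<^sup>2)"
  have S: "S > 0" using False by (simp add: S_def less_le sum_nonneg)
  have [measurable]: "X i \<in> borel_measurable M" for i
    using ind by (auto simp: indep_vars_def)
  define Y where "Y = (\<lambda>l \<omega>. (\<Sum>t\<in>T. a t * X (g l t) \<omega>) / sqrt S)"
  have Y: "indep_vars (\<lambda>_. borel) Y L" "\<And>l. distributed M lborel (Y l) std_normal_density"
    unfolding Y_def S_def by (rule std_normal_block_sums[OF fin(1) ind dist inj S[unfolded S_def]], assumption)+
  have "prob {\<omega> \<in> space M. (\<Sum>l\<in>L. (\<Sum>t\<in>T. a t * X (g l t) \<omega>)\<^sup>2)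
      < S * (real (card L) - 2 * sqrt (real (card L) * x))}
    \<le> prob {\<omega> \<in> space M. (\<Sum>l\<in>L. (Y l \<omega>)\<^sup>2) \<le> real (card L) - 2 * sqrt (real (card L) * x)}"
  proof (rule finite_measure_mono)
    show "{\<omega> \<in> space M. (\<Sum>l\<in>L. (Y l \<omega>)\<^sup>2) \<le> real (card L) - 2 * sqrt (real (card L) * x)} \<in> events"
      unfolding Y_def by measurable
    show "{\<omega> \<in> space M. (\<Sum>l\<in>L. (\<Sum>t\<in>T. a t * X (g l t) \<omega>)\<^sup>2)
      < S * (real (card L) - 2 * sqrt (real (card L) * x))}
      \<subseteq> {\<omega> \<in> space M. (\<Sum>l\<in>L. (Y l \<omega>)\<^sup>2) \<le> real (card L) - 2 * sqrt (real (card L) * x)}"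
      using S by (auto simp: Y_def power_divide pos_divide_le_eq mult.commute simp flip: sum_divide_distrib)
  qed
  also have "\<dots> \<le> exp (- x)"
    by (rule std_normal_sum_squares_lower_tail[OF fin(2,3) Y x])
  finally show ?thesis by (simp add: S_def)
qed

text \<open>Independence makes the joint law a product measure, so a bound uniform over frozen
  values of \<open>X\<close> survives integration over the law of \<open>X\<close>.\<close>

lemma indep_var_prob_le:
  assumes ind: "indep_var S X T Y" and E: "E \<in> sets (S \<Otimes>\<^sub>M T)"
    and le: "\<And>a. a \<in> space S \<Longrightarrow> prob {\<omega> \<in> space M. (a, Y \<omega>) \<in> E} \<le> C"
  shows "prob {\<omega> \<in> space M. (X \<omega>, Y \<omega>) \<in> E} \<le> C"
proof -
  have X[measurable]: "X \<in> measurable M S" and Y[measurable]: "Y \<in> measurable M T"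
    using ind by (auto simp: indep_var_distribution_eq)
  have eq: "distr M (S \<Otimes>\<^sub>M T) (\<lambda>\<omega>. (X \<omega>, Y \<omega>)) = distr M S X \<Otimes>\<^sub>M distr M T Y"
    using ind by (simp add: indep_var_distribution_eq)
  interpret DX: prob_space "distr M S X" by (rule prob_space_distr) measurable
  interpret DY: prob_space "distr M T Y" by (rule prob_space_distr) measurable
  obtain \<omega> where "\<omega> \<in> space M" using not_empty by blast
  then have "X \<omega> \<in> space S" by (rule measurable_space[OF X])
  then have C: "C \<ge> 0" by (rule order_trans[OF measure_nonneg le])
  have "emeasure M {\<omega> \<in> space M. (X \<omega>, Y \<omega>) \<in> E} = emeasure (distr M (S \<Otimes>\<^sub>M T) (\<lambda>\<omega>. (X \<omega>, Y \<omega>))) E"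
    using E by (subst emeasure_distr) (auto intro!: arg_cong[where f="emeasure M"])
  also have "\<dots> = (\<integral>\<^sup>+a. emeasure (distr M T Y) (Pair a -` E) \<partial>distr M S X)"
    unfolding eq using E by (intro DY.emeasure_pair_measure_alt) (simp cong: sets_pair_measure_cong)
  also have "\<dots> \<le> (\<integral>\<^sup>+a. ennreal C \<partial>distr M S X)"
  proof (rule nn_integral_mono)
    fix a assume "a \<in> space (distr M S X)"
    then have a: "a \<in> space S" by simp
    have "emeasure (distr M T Y) (Pair a -` E) = emeasure M (Y -` (Pair a -` E) \<inter> space M)"
      using E by (intro emeasure_distr sets_Pair1) auto
    also have "Y -` (Pair a -` E) \<inter> space M = {\<omega> \<in> space M. (a, Y \<omega>) \<in> E}" by auto
    also have "emeasure M \<dots> \<le> ennreal C"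
      using le[OF a] by (simp add: emeasure_eq_measure ennreal_leI)
    finally show "emeasure (distr M T Y) (Pair a -` E) \<le> ennreal C" .
  qed
  also have "\<dots> = ennreal C" using DX.emeasure_space_1 by simp
  finally show ?thesis using C by (simp add: emeasure_eq_measure)
qed

end

section \<open>Tail events for the model and their almost sure consequences\<close>

locale gaussian_array = prob_space M for M :: "'a measure" +
  fixes v :: "nat \<Rightarrow> 'a \<Rightarrow> real" and z :: "nat \<Rightarrow> nat \<Rightarrow> 'a \<Rightarrow> real"
  assumes indep: "indep_vars (\<lambda>_. borel) (\<lambda>k. case k of Inl i \<Rightarrow> v i | Inr (i, j) \<Rightarrow> z i j) UNIV"
    and v_normal: "\<And>i. distributed M lborel (v i) std_normal_density"
    and z_normal: "\<And>i j. distributed M lborel (z i j) std_normal_density"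
begin

definition entry :: "nat + nat \<times> nat \<Rightarrow> 'a \<Rightarrow> real" where
  "entry = (\<lambda>k. case k of Inl i \<Rightarrow> v i | Inr (i, j) \<Rightarrow> z i j)"

lemma entry_simps [simp]: "entry (Inl i) = v i" "entry (Inr (i, j)) = z i j"
  by (simp_all add: entry_def)

lemma entry_indep: "indep_vars (\<lambda>_. borel) entry UNIV"
  using indep by (simp add: entry_def)

lemma entry_normal: "distributed M lborel (entry k) std_normal_density"
  using v_normal z_normal by (auto simp: entry_def split: sum.split)

lemma v_measurable [measurable]: "v i \<in> borel_measurable M"
  using v_normal[of i] by (simp add: distributed_def)

lemma z_measurable [measurable]: "z i j \<in> borel_measurable M"
  using z_normal[of i j] by (simp add: distributed_def)

lemma signal_energy_lower_tail:
  assumes "n > 0" "x \<ge> 0"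
  shows "prob {\<omega> \<in> space M. (\<Sum>i<n. (v i \<omega>)\<^sup>2) < real n - 2 * sqrt (real n * x)} \<le> exp (- x)"
  \<comment> \<open>Each block is the single variable \<open>v i\<close> with weight 1.\<close>
  using std_normal_block_sums_lower_tail[of "{()}" "{..<n}" entry "\<lambda>i _. Inl i" x "\<lambda>_. 1"]
    assms entry_indep entry_normal by auto

text \<open>Conditionally on the \<open>v i\<close>, the column sums are independent centred Gaussians with common
  variance \<open>\<Sum>i<n. (v i)\<^sup>2\<close>.\<close>

lemma cross_term_upper_tail:
  assumes n: "n > 0" and p: "p > 0" and x: "x \<ge> 0"
  shows "prob {\<omega> \<in> space M. (\<Sum>i<n. (v i \<omega>)\<^sup>2) * (real p + 2 * sqrt (real p * x) + 2 * x)
      < (\<Sum>j<p. (\<Sum>i<n. v i \<omega> * z i j \<omega>)\<^sup>2)} \<le> exp (- x)"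
proof -
  define IV where "IV = (Inl ` {..<n} :: (nat + nat \<times> nat) set)"
  define IZ where "IZ = (Inr ` ({..<n} \<times> {..<p}) :: (nat + nat \<times> nat) set)"
  define V where "V = (\<lambda>\<omega>. restrict (\<lambda>k. entry k \<omega>) IV)"
  define Z where "Z = (\<lambda>\<omega>. restrict (\<lambda>k. entry k \<omega>) IZ)"
  define SV where "SV = PiM IV (\<lambda>_. borel :: real measure)"
  define SZ where "SZ = PiM IZ (\<lambda>_. borel :: real measure)"
  define B where "B = real p + 2 * sqrt (real p * x) + 2 * x"
  define E where "E = {w \<in> space (SV \<Otimes>\<^sub>M SZ). (\<Sum>i<n. (fst w (Inl i))\<^sup>2) * B
      < (\<Sum>j<p. (\<Sum>i<n. fst w (Inl i) * snd w (Inr (i, j)))\<^sup>2)}"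
  have ind: "indep_var SV V SZ Z"
    unfolding SV_def SZ_def V_def Z_def
    by (rule indep_var_restrict[OF entry_indep]) (auto simp: IV_def IZ_def)
  have mV[measurable]: "(\<lambda>w. fst w (Inl i)) \<in> borel_measurable (SV \<Otimes>\<^sub>M SZ)" if "i < n" for i
    using that unfolding SV_def
    by (intro measurable_compose[OF measurable_fst measurable_component_singleton]) (auto simp: IV_def)
  have mZ[measurable]: "(\<lambda>w. snd w (Inr (i, j))) \<in> borel_measurable (SV \<Otimes>\<^sub>M SZ)" if "i < n" "j < p" for i j
    using that unfolding SZ_def
    by (intro measurable_compose[OF measurable_snd measurable_component_singleton]) (auto simp: IZ_def)
  have "(\<lambda>w. (\<Sum>i<n. (fst w (Inl i))\<^sup>2) * B) \<in> borel_measurable (SV \<Otimes>\<^sub>M SZ)"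
    by (intro borel_measurable_times borel_measurable_sum borel_measurable_power borel_measurable_const mV) auto
  moreover have "(\<lambda>w. \<Sum>j<p. (\<Sum>i<n. fst w (Inl i) * snd w (Inr (i, j)))\<^sup>2) \<in> borel_measurable (SV \<Otimes>\<^sub>M SZ)"
    by (intro borel_measurable_times borel_measurable_sum borel_measurable_power mV mZ) auto
  ultimately have E: "E \<in> sets (SV \<Otimes>\<^sub>M SZ)"
    unfolding E_def by (rule borel_measurable_less)
  have mem: "V \<omega> \<in> space SV" "Z \<omega> \<in> space SZ" for \<omega>
    by (auto simp: V_def Z_def SV_def SZ_def space_PiM)
  have ent: "V \<omega> (Inl i) = v i \<omega>" if "i < n" for i \<omega>
    using that by (simp add: V_def IV_def)
  have entZ: "Z \<omega> (Inr (i, j)) = z i j \<omega>" if "i < n" "j < p" for i j \<omega>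
    using that by (simp add: Z_def IZ_def)
  have "prob {\<omega> \<in> space M. (V \<omega>, Z \<omega>) \<in> E} \<le> exp (- x)"
  proof (rule indep_var_prob_le[OF ind E])
    fix a assume a: "a \<in> space SV"
    have "{\<omega> \<in> space M. (a, Z \<omega>) \<in> E} = {\<omega> \<in> space M. (\<Sum>i<n. (a (Inl i))\<^sup>2) * B
        < (\<Sum>j<p. (\<Sum>i<n. a (Inl i) * z i j \<omega>)\<^sup>2)}"
      using a mem by (simp add: E_def space_pair_measure entZ)
    \<comment> \<open>With the \<open>v i\<close> frozen as weights, each column \<open>j\<close> of
      the noise forms one block.\<close>
    also have "prob \<dots> \<le> exp (- x)"
      using std_normal_block_sums_upper_tail[of "{..<n}" "{..<p}" entry "\<lambda>j i. Inr (i, j)" x "\<lambda>i. a (Inl i)"]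
        p x entry_indep entry_normal by (auto simp: B_def)
    finally show "prob {\<omega> \<in> space M. (a, Z \<omega>) \<in> E} \<le> exp (- x)" .
  qed
  also have "{\<omega> \<in> space M. (V \<omega>, Z \<omega>) \<in> E} = {\<omega> \<in> space M. (\<Sum>i<n. (v i \<omega>)\<^sup>2) * B
      < (\<Sum>j<p. (\<Sum>i<n. v i \<omega> * z i j \<omega>)\<^sup>2)}"
    using mem by (simp add: E_def space_pair_measure ent entZ)
  finally show ?thesis by (simp add: B_def)
qed

text \<open>The projections of the \<open>n\<close> noise vectors on \<open>m\<close> are
  independent centred normals of variance \<open>vdot p m m\<close>, so their squares sum to a
  scaled chi-square with \<open>n\<close> degrees of freedom. Both tails are used at parameter
  \<open>n * x\<close>, and division by \<open>n\<close> leaves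
  \<open>2 * sqrt x + 2 * x\<close>.\<close>

lemma quadratic_form_deviation:
  fixes m :: "nat \<Rightarrow> real"
  assumes n: "n > 0" and x: "x \<ge> 0"
  shows "prob {\<omega> \<in> space M. (2 * sqrt x + 2 * x) * vdot p m m
      < \<bar>(\<Sum>i<n. (vdot p (\<lambda>j. z i j \<omega>) m)\<^sup>2) / real n - vdot p m m\<bar>} \<le> 2 * exp (- (real n * x))"
proof -
  define D where "D = vdot p m m"
  define T where "T = (\<lambda>\<omega>. \<Sum>i<n. (vdot p (\<lambda>j. z i j \<omega>) m)\<^sup>2)"
  have D: "D = (\<Sum>j<p. (m j)\<^sup>2)" by (simp add: D_def vdot_def power2_eq_square)
  have D0: "D \<ge> 0" by (simp add: D sum_nonneg)
  have T: "T \<omega> = (\<Sum>i<n. (\<Sum>j<p. m j * entry (Inr (i, j)) \<omega>)\<^sup>2)" for \<omega>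
    by (simp add: T_def vdot_def mult.commute)
  have [measurable]: "T \<in> borel_measurable M"
    unfolding T_def vdot_def by measurable
  have sq: "sqrt (real n * (real n * x)) = real n * sqrt x"
    by (simp add: real_sqrt_mult)
  define U where "U = {\<omega> \<in> space M. D * (real n + 2 * (real n * sqrt x) + 2 * (real n * x)) < T \<omega>}"
  define L where "L = {\<omega> \<in> space M. T \<omega> < D * (real n - 2 * (real n * sqrt x))}"
  have ev: "U \<in> events" "L \<in> events" unfolding U_def L_def by measurable
  have "prob U \<le> exp (- (real n * x))"
    using std_normal_block_sums_upper_tail[of "{..<p}" "{..<n}" entry "\<lambda>i j. Inr (i, j)" "real n * x" m]
      n x entry_indep entry_normal by (auto simp: U_def D T sq simp del: entry_simps)
  moreover have "prob L \<le> exp (- (real n * x))"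
    using std_normal_block_sums_lower_tail[of "{..<p}" "{..<n}" entry "\<lambda>i j. Inr (i, j)" "real n * x" m]
      n x entry_indep entry_normal by (auto simp: L_def D T sq simp del: entry_simps)
  moreover have "prob {\<omega> \<in> space M. (2 * sqrt x + 2 * x) * D < \<bar>T \<omega> / real n - D\<bar>} \<le> prob (U \<union> L)"
  proof (rule finite_measure_mono)
    show "{\<omega> \<in> space M. (2 * sqrt x + 2 * x) * D < \<bar>T \<omega> / real n - D\<bar>} \<subseteq> U \<union> L"
    proof
      fix \<omega> assume "\<omega> \<in> {\<omega> \<in> space M. (2 * sqrt x + 2 * x) * D < \<bar>T \<omega> / real n - D\<bar>}"
      then have \<omega>: "\<omega> \<in> space M" and "(2 * sqrt x + 2 * x) * D < \<bar>T \<omega> / real n - D\<bar>" by auto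
      then consider "(2 * sqrt x + 2 * x) * D + D < T \<omega> / real n" | "T \<omega> / real n < D - (2 * sqrt x + 2 * x) * D"
        by linarith
      then show "\<omega> \<in> U \<union> L"
      proof cases
        case 1
        then have "\<omega> \<in> U" using n \<omega> by (simp add: U_def pos_less_divide_eq algebra_simps)
        then show ?thesis by simp
      next
        case 2
        moreover have "D - (2 * sqrt x + 2 * x) * D \<le> D - 2 * sqrt x * D"
          using D0 x by (simp add: algebra_simps)
        ultimately have "T \<omega> / real n < D - 2 * sqrt x * D" by linarith
        then have "T \<omega> < (D - 2 * sqrt x * D) * real n" using n by (simp only: pos_divide_less_eq of_nat_0_less_iff)
        then have "\<omega> \<in> L" using n \<omega> by (simp add: L_def algebra_simps)
        then show ?thesis by simp
      qed
    qed
  qed (use ev in simp)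
  moreover have "prob (U \<union> L) \<le> prob U + prob L" using ev by (rule measure_Un_le)
  ultimately show ?thesis by (simp add: T_def D_def)
qed

definition net_failure :: "nat \<Rightarrow> nat \<Rightarrow> real \<Rightarrow> 'a set" where
  "net_failure n p x = (\<Union>k\<in>int_net p. {\<omega> \<in> space M. (2 * sqrt x + 2 * x) * vdot p (\<lambda>j. real_of_int (k j)) (\<lambda>j. real_of_int (k j))
      < \<bar>(\<Sum>i<n. (vdot p (\<lambda>j. z i j \<omega>) (\<lambda>j. real_of_int (k j)))\<^sup>2) / real n
          - vdot p (\<lambda>j. real_of_int (k j)) (\<lambda>j. real_of_int (k j))\<bar>})"

lemma net_failure_event: "net_failure n p x \<in> events"
  unfolding net_failure_def vdot_def
  by (rule sets.finite_UN[OF finite_int_net]) measurable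

text \<open>The part \<open>8 / 3 * (p / n)\<close> of the parameter cancels the net size
  \<open>exp (8 * p / 3)\<close> in the union bound; the slack \<open>h\<close> is what remains to
  make the probabilities summable in \<open>n\<close>.\<close>

lemma prob_net_failure:
  assumes n: "n > 0" and h: "h > 0"
  shows "prob (net_failure n p (8 / 3 * (real p / real n) + h)) \<le> 2 * exp (- (h * real n))"
proof -
  define x where "x = 8 / 3 * (real p / real n) + h"
  have x: "x \<ge> 0" using h by (simp add: x_def)
  have "prob (net_failure n p x) \<le> (\<Sum>k\<in>int_net p. 2 * exp (- (real n * x)))"
    unfolding net_failure_def
  proof (rule order_trans[OF finite_measure_subadditive_finite[OF finite_int_net] sum_mono])
    show "(\<lambda>k. {\<omega> \<in> space M. (2 * sqrt x + 2 * x) * vdot p (\<lambda>j. real_of_int (k j)) (\<lambda>j. real_of_int (k j))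
      < \<bar>(\<Sum>i<n. (vdot p (\<lambda>j. z i j \<omega>) (\<lambda>j. real_of_int (k j)))\<^sup>2) / real n
          - vdot p (\<lambda>j. real_of_int (k j)) (\<lambda>j. real_of_int (k j))\<bar>}) ` int_net p \<subseteq> events"
      unfolding vdot_def by (intro image_subsetI) measurable
  qed (rule quadratic_form_deviation[OF n x])
  also have "\<dots> = real (card (int_net p)) * (2 * exp (- (real n * x)))" by simp
  also have "\<dots> \<le> exp (8 / 3) ^ p * (2 * exp (- (real n * x)))"
    using order_trans[OF card_int_net_le power_mono[OF exp_eight_thirds_ge]]
    by (intro mult_right_mono) auto
  also have "\<dots> = 2 * exp (real p * (8 / 3) - real n * x)"
    unfolding exp_of_nat_mult[symmetric] diff_conv_add_uminus exp_add by simp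
  also have "real p * (8 / 3) - real n * x = - (h * real n)"
    using n by (simp add: x_def field_simps)
  finally show ?thesis by (simp add: x_def)
qed

lemma not_net_failureD:
  assumes "\<omega> \<in> space M" "\<omega> \<notin> net_failure n p x" "x \<ge> 0"
  shows "\<bar>(\<Sum>i<n. (vdot p (\<lambda>j. z i j \<omega>) w)\<^sup>2) / real n - (vnorm p w)\<^sup>2\<bar>
    \<le> 9 / 8 * (2 * sqrt x + 2 * x) * (vnorm p w)\<^sup>2"
  unfolding vnorm_sq
proof (rule quadratic_form_bound_from_integer_net)
  fix m :: "nat \<Rightarrow> real"
  assume "\<And>j. j < p \<Longrightarrow> m j \<in> \<int>" "vdot p m m \<le> 9 * real p"
  then obtain k where k: "k \<in> int_net p" and mk: "\<And>j. j < p \<Longrightarrow> m j = of_int (k j)"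
    using int_net_represents[of p m] by blast
  have "vdot p u m = vdot p u (\<lambda>j. real_of_int (k j))" for u
    by (rule vdot_cong) (auto simp: mk)
  moreover have "vdot p m m = vdot p (\<lambda>j. real_of_int (k j)) (\<lambda>j. real_of_int (k j))"
    by (rule vdot_cong) (auto simp: mk)
  ultimately show "\<bar>(\<Sum>i<n. (vdot p (\<lambda>j. z i j \<omega>) m)\<^sup>2) / real n - vdot p m m\<bar> \<le> (2 * sqrt x + 2 * x) * vdot p m m"
    using assms k by (auto simp: net_failure_def not_less)
qed (use assms in simp)

text \<open>Borel-Cantelli: with every slack of size \<open>h * n\<close>, the three failure events
  have total probability at most \<open>4 * exp (- h) ^ n\<close>.\<close>

lemma AE_eventually_regular:
  fixes p :: "nat \<Rightarrow> nat"
  assumes h: "h > 0"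
  shows "AE \<omega> in M. \<forall>\<^sub>F n in sequentially. 0 < p n \<longrightarrow>
      real n * (1 - 2 * sqrt h) \<le> (\<Sum>i<n. (v i \<omega>)\<^sup>2) \<and>
      (\<Sum>j<p n. (\<Sum>i<n. v i \<omega> * z i j \<omega>)\<^sup>2)
        \<le> (\<Sum>i<n. (v i \<omega>)\<^sup>2) * (real (p n) + 2 * sqrt (real (p n) * (h * real n)) + 2 * (h * real n)) \<and>
      \<omega> \<in> space M - net_failure n (p n) (8 / 3 * (real (p n) / real n) + h)"
proof -
  define F1 where "F1 = (\<lambda>n. {\<omega> \<in> space M. (\<Sum>i<n. (v i \<omega>)\<^sup>2) < real n - 2 * sqrt (real n * (h * real n))})"
  define F2 where "F2 = (\<lambda>n. {\<omega> \<in> space M. (\<Sum>i<n. (v i \<omega>)\<^sup>2)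
        * (real (p n) + 2 * sqrt (real (p n) * (h * real n)) + 2 * (h * real n))
      < (\<Sum>j<p n. (\<Sum>i<n. v i \<omega> * z i j \<omega>)\<^sup>2)})"
  define F3 where "F3 = (\<lambda>n. net_failure n (p n) (8 / 3 * (real (p n) / real n) + h))"
  \<comment> \<open>The tail bounds require nonempty index sets, so degenerate \<open>n\<close>
    contribute the empty event; the conclusion speaks only of \<open>p n > 0\<close> and of large
    \<open>n\<close>.\<close>
  define F where "F = (\<lambda>n. if n > 0 \<and> p n > 0 then F1 n \<union> F2 n \<union> F3 n else {})"
  have ev: "F1 n \<in> events" "F2 n \<in> events" "F3 n \<in> events" for n
    unfolding F1_def F2_def F3_def by (measurable, measurable, rule net_failure_event)
  have "prob (F n) \<le> 4 * exp (- h) ^ n" for n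
  proof (cases "n > 0 \<and> p n > 0")
    case True
    have "prob (F n) \<le> prob (F1 n \<union> F2 n) + prob (F3 n)"
      using True ev by (simp add: F_def measure_Un_le)
    also have "prob (F1 n \<union> F2 n) \<le> prob (F1 n) + prob (F2 n)"
      using ev by (simp add: measure_Un_le)
    also have "prob (F1 n) \<le> exp (- (h * real n))"
      unfolding F1_def using True h by (intro signal_energy_lower_tail) auto
    also have "prob (F2 n) \<le> exp (- (h * real n))"
      unfolding F2_def using True h by (intro cross_term_upper_tail) auto
    also have "prob (F3 n) \<le> 2 * exp (- (h * real n))"
      unfolding F3_def using True h by (intro prob_net_failure) auto
    also have "exp (- (h * real n)) = exp (- h) ^ n"
      by (simp add: mult.commute flip: exp_of_nat_mult)
    finally show ?thesis by simp
  qed (auto simp: F_def)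
  then have "summable (\<lambda>n. prob (F n))"
    using h by (intro summable_comparison_test[OF _ summable_mult[OF summable_geometric, of "exp (- h)" 4]]) auto
  moreover have "F n \<in> events" for n using ev by (auto simp: F_def)
  ultimately have "AE \<omega> in M. \<forall>\<^sub>F n in sequentially. \<omega> \<in> space M - F n"
    by (intro borel_cantelli_AE1) (auto simp: less_top[symmetric])
  then show ?thesis
  proof eventually_elim
    case (elim \<omega>)
    then show ?case
      using eventually_gt_at_top[of 0]
    proof eventually_elim
      case (elim n)
      have "sqrt (real n * (h * real n)) = real n * sqrt h" by (simp add: real_sqrt_mult)
      then show ?case using elim by (auto simp: F_def F1_def F2_def F3_def not_less algebra_simps)
    qed
  qed
qed

end

section \<open>The bound on the angle\<close>

text \<open>The cross term obeys \<open>b \<le> sqrt (A * B)\<close>, so after division by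
  \<open>A * r^2\<close> both summands decrease in \<open>A\<close>, and a lower bound on the signal
  energy suffices. The condition \<open>h < 1 / 4\<close> keeps that lower bound positive.\<close>

lemma sin_angle_le_of_regular:
  fixes n p :: nat and V :: "nat \<Rightarrow> real" and Z :: "nat \<Rightarrow> nat \<Rightarrow> real" and rho u :: "nat \<Rightarrow> real"
  defines "y \<equiv> real p / real n" and "r \<equiv> vnorm p rho"
  assumes n: "n > 0" and sig: "\<sigma> > 0" and h: "0 < h" "h < 1 / 4" and r: "r > 0"
    and u: "is_top_unit_eigvec p (sample_cov n p (\<lambda>i j. V i * rho j + \<sigma> * Z i j)) u"
    and V: "real n * (1 - 2 * sqrt h) \<le> (\<Sum>i<n. (V i)\<^sup>2)"
    and VZ: "(\<Sum>j<p. (\<Sum>i<n. V i * Z i j)\<^sup>2)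
        \<le> (\<Sum>i<n. (V i)\<^sup>2) * (real p + 2 * sqrt (real p * (h * real n)) + 2 * (h * real n))"
    and K: "\<And>w. \<bar>(\<Sum>i<n. (vdot p (Z i) w)\<^sup>2) / real n - (vnorm p w)\<^sup>2\<bar> \<le> K * (vnorm p w)\<^sup>2"
    and K0: "K \<ge> 0"
  shows "sin_angle p u rho \<le> 2 * \<sigma> * sqrt (y + 2 * sqrt (y * h) + 2 * h) / (r * sqrt (1 - 2 * sqrt h))
     + 2 * \<sigma>\<^sup>2 * K / ((1 - 2 * sqrt h) * r\<^sup>2)"
proof -
  define A where "A = (\<Sum>i<n. (V i)\<^sup>2) / real n"
  define B where "B = y + 2 * sqrt (y * h) + 2 * h"
  define b where "b = vnorm p (\<lambda>j. (\<Sum>i<n. V i * Z i j) / real n)"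
  define a0 where "a0 = 1 - 2 * sqrt h"
  have "sqrt h < sqrt (1 / 4)" using h by (simp only: real_sqrt_less_iff)
  then have a0: "a0 > 0" by (simp add: a0_def real_sqrt_divide)
  have A: "a0 \<le> A" using V n by (simp add: a0_def A_def pos_le_divide_eq mult.commute)
  have y: "y \<ge> 0" by (simp add: y_def)
  have B: "B \<ge> 0" using y h by (simp add: B_def)
  have "real p + 2 * sqrt (real p * (h * real n)) + 2 * (h * real n) = real n * B"
  proof -
    have "real p * (h * real n) = (real n)\<^sup>2 * (y * h)"
      using n by (simp add: y_def power2_eq_square)
    then have "sqrt (real p * (h * real n)) = real n * sqrt (y * h)"
      by (simp only: real_sqrt_mult real_sqrt_abs abs_of_nat)
    then show ?thesis using n by (simp add: B_def y_def algebra_simps)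
  qed
  then have "(\<Sum>j<p. (\<Sum>i<n. V i * Z i j)\<^sup>2) / (real n)\<^sup>2 \<le> A * B"
    using VZ n by (simp add: A_def divide_simps power2_eq_square mult_ac)
  then have "b\<^sup>2 \<le> A * B"
    by (simp add: b_def vnorm_def power_divide sum_nonneg flip: sum_divide_distrib)
  then have b: "b \<le> sqrt A * sqrt B"
    by (metis real_le_rsqrt real_sqrt_mult)
  have Apos: "A > 0" using a0 A by simp
  have "sin_angle p u rho \<le> (2 * \<sigma> * r * b + 2 * \<sigma>\<^sup>2 * K) / (A * r\<^sup>2)"
    using sin_angle_top_eigvec_le[OF n sig _ u K K0] r Apos n
    by (simp add: r_def A_def b_def zero_less_divide_iff)
  also have "\<dots> \<le> (2 * \<sigma> * r * (sqrt A * sqrt B) + 2 * \<sigma>\<^sup>2 * K) / (A * r\<^sup>2)"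
    using b sig r Apos by (intro divide_right_mono add_right_mono mult_left_mono) auto
  also have "\<dots> = 2 * \<sigma> * sqrt B / (r * sqrt A) + 2 * \<sigma>\<^sup>2 * K / (A * r\<^sup>2)"
  proof -
    have "sqrt A * sqrt A = A" using Apos by simp
    then have "2 * \<sigma> * r * (sqrt A * sqrt B) / (A * r\<^sup>2) = 2 * \<sigma> * sqrt B / (r * sqrt A)"
      using Apos r by (simp add: frac_eq_eq power2_eq_square)
    then show ?thesis by (simp add: add_divide_distrib)
  qed
  also have "\<dots> \<le> 2 * \<sigma> * sqrt B / (r * sqrt a0) + 2 * \<sigma>\<^sup>2 * K / (a0 * r\<^sup>2)"
    using a0 A sig r B K0
    by (intro add_mono divide_left_mono mult_left_mono mult_right_mono mult_nonneg_nonneg mult_pos_pos) auto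
  finally show ?thesis by (simp add: B_def a0_def)
qed

theorem theorem1:
  fixes M :: "'a measure"
    and v :: "nat \<Rightarrow> 'a \<Rightarrow> real"
    and z :: "nat \<Rightarrow> nat \<Rightarrow> 'a \<Rightarrow> real"
    and p :: "nat \<Rightarrow> nat"
    and rho :: "nat \<Rightarrow> nat \<Rightarrow> real"
    and rhohat :: "nat \<Rightarrow> 'a \<Rightarrow> nat \<Rightarrow> real"
    and \<sigma> c vrho :: real
  assumes M: "prob_space M"
    and indep: "prob_space.indep_vars M (\<lambda>_. borel)
                  (\<lambda>k. case k of Inl i \<Rightarrow> v i | Inr (i, j) \<Rightarrow> z i j) UNIV"
    and v_normal: "\<And>i. distributed M lborel (v i) std_normal_density"
    and z_normal: "\<And>i j. distributed M lborel (z i j) std_normal_density"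
    and sigma_pos: "\<sigma> > 0"
    and ratio: "(\<lambda>n. real (p n) / real n) \<longlonglongrightarrow> c"
    and c_nonneg: "c \<ge> 0"
    and rho_lim: "(\<lambda>n. vnorm (p n) (rho n)) \<longlonglongrightarrow> vrho"
    and varrho_pos: "vrho > 0"
    and rhohat: "\<And>n \<omega>. p n > 0 \<Longrightarrow>
        is_top_unit_eigvec (p n)
          (sample_cov n (p n) (\<lambda>i j. v i \<omega> * rho n j + \<sigma> * z i j \<omega>))
          (rhohat n \<omega>)"
    and zeta_le: "zeta (vrho / \<sigma>) c \<le> 1"
  shows "AE \<omega> in M.
           limsup (\<lambda>n. ereal (sin_angle (p n) (rhohat n \<omega>) (rho n)))
             \<le> ereal (zeta (vrho / \<sigma>) c)"
proof -
  interpret gaussian_array M v z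
    using M indep v_normal z_normal by (simp add: gaussian_array_def gaussian_array_axioms_def)
  define t where "t = (\<lambda>h y :: real. 2 * sqrt (8 / 3 * y + h) + 2 * (8 / 3 * y + h))"
  define bound where "bound = (\<lambda>h y r. 2 * \<sigma> * sqrt (y + 2 * sqrt (y * h) + 2 * h) / (r * sqrt (1 - 2 * sqrt h))
     + 2 * \<sigma>\<^sup>2 * (9 / 8 * t h y) / ((1 - 2 * sqrt h) * r\<^sup>2))"
  \<comment> \<open>Countably many slacks tending to 0, all below \<open>1 / 4\<close>, so that a
    single null set serves every \<open>k\<close> before the limit in \<open>k\<close> is
    taken.\<close>
  define h where "h = (\<lambda>k. 1 / real (k + 5))"
  have h: "0 < h k" "h k < 1 / 4" for k by (auto simp: h_def field_simps)
  have a0: "1 - 2 * sqrt (h k) > 0" for k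
  proof -
    have "sqrt (h k) < sqrt (1 / 4)" using h by (simp only: real_sqrt_less_iff)
    then show ?thesis by (simp add: real_sqrt_divide)
  qed
  have rpos: "\<forall>\<^sub>F n in sequentially. vnorm (p n) (rho n) > 0"
    using order_tendstoD(1)[OF rho_lim varrho_pos] .
  have "AE \<omega> in M. \<forall>k. \<forall>\<^sub>F n in sequentially. 0 < p n \<longrightarrow>
      real n * (1 - 2 * sqrt (h k)) \<le> (\<Sum>i<n. (v i \<omega>)\<^sup>2) \<and>
      (\<Sum>j<p n. (\<Sum>i<n. v i \<omega> * z i j \<omega>)\<^sup>2)
        \<le> (\<Sum>i<n. (v i \<omega>)\<^sup>2) * (real (p n) + 2 * sqrt (real (p n) * (h k * real n)) + 2 * (h k * real n)) \<and>
      \<omega> \<in> space M - net_failure n (p n) (8 / 3 * (real (p n) / real n) + h k)"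
    unfolding AE_all_countable using h by (intro allI AE_eventually_regular)
  then show ?thesis
  proof eventually_elim
    case (elim \<omega>)
    have le: "limsup (\<lambda>n. ereal (sin_angle (p n) (rhohat n \<omega>) (rho n))) \<le> ereal (bound (h k) c vrho)" for k
    proof -
      have "\<forall>\<^sub>F n in sequentially. sin_angle (p n) (rhohat n \<omega>) (rho n)
          \<le> bound (h k) (real (p n) / real n) (vnorm (p n) (rho n))"
        using elim[rule_format, of k] rpos eventually_gt_at_top[of 0]
      proof eventually_elim
        case (elim n)
        \<comment> \<open>In dimension 0 every norm is 0, so eventual positivity of the norm of
          \<open>rho n\<close> makes the hypothesis on \<open>rhohat\<close> available.\<close>
        have p: "p n > 0" using elim(2) by (cases "p n") (auto simp: vnorm_def)
        note reg = elim(1)[rule_format, OF p]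
        have x: "8 / 3 * (real (p n) / real n) + h k \<ge> 0" using h[of k] by simp
        show ?case
          unfolding bound_def
        proof (rule sin_angle_le_of_regular[OF elim(3) sigma_pos h elim(2) rhohat[OF p]])
          show "real n * (1 - 2 * sqrt (h k)) \<le> (\<Sum>i<n. (v i \<omega>)\<^sup>2)" using reg by blast
          show "(\<Sum>j<p n. (\<Sum>i<n. v i \<omega> * z i j \<omega>)\<^sup>2)
            \<le> (\<Sum>i<n. (v i \<omega>)\<^sup>2) * (real (p n) + 2 * sqrt (real (p n) * (h k * real n)) + 2 * (h k * real n))"
            using reg by blast
          show "\<bar>(\<Sum>i<n. (vdot (p n) (\<lambda>j. z i j \<omega>) w)\<^sup>2) / real n - (vnorm (p n) w)\<^sup>2\<bar>
            \<le> 9 / 8 * t (h k) (real (p n) / real n) * (vnorm (p n) w)\<^sup>2" for w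
            unfolding t_def using reg x by (intro not_net_failureD) auto
          show "0 \<le> 9 / 8 * t (h k) (real (p n) / real n)"
            unfolding t_def using x by simp
        qed
      qed
      then have "limsup (\<lambda>n. ereal (sin_angle (p n) (rhohat n \<omega>) (rho n)))
          \<le> limsup (\<lambda>n. ereal (bound (h k) (real (p n) / real n) (vnorm (p n) (rho n))))"
        by (intro Limsup_mono) simp
      also have "(\<lambda>n. bound (h k) (real (p n) / real n) (vnorm (p n) (rho n))) \<longlonglongrightarrow> bound (h k) c vrho"
        unfolding bound_def t_def using a0[of k] varrho_pos
        by (intro tendsto_intros ratio rho_lim) auto
      then have "limsup (\<lambda>n. ereal (bound (h k) (real (p n) / real n) (vnorm (p n) (rho n)))) = ereal (bound (h k) c vrho)"
        by (intro lim_imp_Limsup) auto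
      finally show ?thesis .
    qed
    have "(\<lambda>k. ereal (bound (h k) c vrho)) \<longlonglongrightarrow> ereal (bound 0 c vrho)"
    proof -
      have "h \<longlonglongrightarrow> 0"
        unfolding h_def by (rule LIMSEQ_ignore_initial_segment[OF lim_1_over_n])
      then show ?thesis
        unfolding bound_def t_def using varrho_pos by (intro tendsto_intros) auto
    qed
    then have "limsup (\<lambda>n. ereal (sin_angle (p n) (rhohat n \<omega>) (rho n))) \<le> ereal (bound 0 c vrho)"
      by (rule LIMSEQ_le_const) (use le in blast)
    also have "bound 0 c vrho \<le> zeta (vrho / \<sigma>) c"
    proof -
      \<comment> \<open>With \<open>q\<close> the inverse of the signal-to-noise ratio and
        \<open>s = sqrt c\<close>, both sides become polynomials in \<open>s\<close> and
        \<open>q\<close>, to be compared term by term.\<close>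
      define q where "q = \<sigma> / vrho"
      define s where "s = sqrt c"
      have q: "q > 0" using sigma_pos varrho_pos by (simp add: q_def)
      have s: "s \<ge> 0" "c = s\<^sup>2" using c_nonneg by (auto simp: s_def)
      have zeta: "zeta (vrho / \<sigma>) c = 4 * s * q + (8 * s + 4 * s\<^sup>2) * q\<^sup>2"
        using sigma_pos varrho_pos
        by (simp add: zeta_def q_def power_divide field_simps power2_eq_square flip: s_def)
      have "4 * s * q \<le> 1"
        using zeta_le s(1) q unfolding zeta by (smt (verit) mult_nonneg_nonneg zero_le_power2)
      \<comment> \<open>The limit bound exceeds \<open>zeta\<close> by \<open>8 * s^2 * q^2\<close>
        in the \<open>s^2 * q^2\<close> term, but falls short by \<open>2 * s * q\<close> in the
        first-order term; \<open>4 * s * q \<le> 1\<close> lets the latter pay for the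
        former.\<close>
      then have "(4 * s * q) * (2 * s * q) \<le> 1 * (2 * s * q)"
        using s(1) q by (intro mult_right_mono) auto
      then have sq: "8 * s\<^sup>2 * q\<^sup>2 \<le> 2 * s * q" by (simp add: power2_eq_square mult_ac)
      \<comment> \<open>The value \<open>16 / 9\<close> is exactly what turns the coefficient
        \<open>9 / 2 * sqrt (8 / 3)\<close> into the 8 of \<open>zeta\<close>.\<close>
      have "sqrt (8 / 3) \<le> (16 / 9 :: real)" by (rule real_le_lsqrt) (auto simp: power2_eq_square)
      then have "sqrt (8 / 3) * s \<le> 16 / 9 * s"
        using s(1) by (rule mult_right_mono)
      then have "9 / 2 * (sqrt (8 / 3) * s) * q\<^sup>2 \<le> 8 * s * q\<^sup>2"
        by (intro mult_right_mono) auto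
      moreover have "bound 0 c vrho = 2 * s * q + (9 / 2 * (sqrt (8 / 3) * s) + 12 * s\<^sup>2) * q\<^sup>2"
      proof -
        have "sqrt (8 / 3 * c) = sqrt (8 / 3) * s" by (simp only: real_sqrt_mult s_def)
        then have "bound 0 c vrho = 2 * \<sigma> * s / vrho + 2 * \<sigma>\<^sup>2 * (9 / 8 * (2 * (sqrt (8 / 3) * s) + 16 / 3 * s\<^sup>2)) / vrho\<^sup>2"
          using s by (simp add: bound_def t_def)
        then show ?thesis by (simp add: q_def power_divide algebra_simps add_divide_distrib)
      qed
      ultimately show ?thesis unfolding zeta using sq by (simp add: algebra_simps)
    qed
    finally show ?case by simp
  qed
qed

end
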